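(* Let $R$ be a non-discrete irreducible, continuous ring. Then $\mathrm{GL}(R)$, endowed with the rank topology, is bounded in the sense of Bourbaki.
   Context: All rings are unital. A ring $R$ is regular if for every $a \in R$ there is $b \in R$ with $aba=a$. For a regular ring $R$, the set $L(R)=\{aR : a\in R\}$, ordered by inclusion, is a complemented modular lattice. A continuous ring is a regular ring $R$ such that the lattice $L(R)$ is complete and satisfies $I\wedge\bigvee C=\bigvee\{I\wedge J : J\in C\}$ and $I\vee\bigwedge C=\bigwedge\{I\vee J : J\in C\}$ for every chain $C\subseteq L(R)$ and every $I\in L(R)$. A ring is irreducible if it is non-zero and not isomorphic to a direct product of two non-zero rings. A rank function on a regular ring $R$ is a map $\rho\colon R\to[0,1]$ with $\rho(1)=1$, $\rho(ab)\le\min\{\rho(a),\rho(b)\}$ for all $a,b \in R$, $\rho(e+f)=\rho(e)+\rho(f)$ for any idempotents $e,f$ with $ef=fe=0$, and $\rho(a)=0$ only if $a=0$. Every irreducible, continuous ring $R$ has a unique rank function, denoted $\mathrm{rk}_R$; the rank metric is $d_R(a,b)=\mathrm{rk}_R(a-b)$, and the topology it generates is the rank topology. $R$ is non-discrete if its rank topology is not discrete. $\mathrm{GL}(R)$ denotes the group of units of $R$; the restriction of $d_R$ to it is a bi-invariant metric. A uniform space $X$ is bounded (in the sense of Bourbaki) if for every entourage $U$ of $X$ there exist $n\in\mathbb{N}$ and a finite subset $F\subseteq X$ such that for every $x_n\in X$ there are $x_0\in F$ and $x_1,\ldots,x_{n-1}\in X$ with $(x_i,x_{i+1})\in U$ for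 all $i\in\{0,\ldots,n-1\}$. The group $\mathrm{GL}(R)$ is regarded as a uniform space with the uniformity generated by $d_R$, which coincides with both its left and its right uniformity as a topological group. *)

theory Defs
  imports "HOL-Analysis.Analysis" "HOL-Algebra.Algebra"
begin

definition regular_ring :: "('a, 'm) ring_scheme \<Rightarrow> bool" where
  "regular_ring R \<longleftrightarrow> ring R \<and>
     (\<forall>a\<in>carrier R. \<exists>b\<in>carrier R. a \<otimes>\<^bsub>R\<^esub> b \<otimes>\<^bsub>R\<^esub> a = a)"

definition principal_right_ideals :: "('a, 'm) ring_scheme \<Rightarrow> 'a set gorder" where
  "principal_right_ideals R =
     \<lparr>carrier = {a <#\<^bsub>R\<^esub> carrier R | a. a \<in> carrier R}, eq = (=), le = (\<subseteq>)\<rparr>"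

definition continuous_ring :: "('a, 'm) ring_scheme \<Rightarrow> bool" where
  "continuous_ring R \<longleftrightarrow> regular_ring R \<and>
     (let L = principal_right_ideals R in
        complete_lattice L \<and>
        (\<forall>C\<subseteq>carrier L. \<forall>I\<in>carrier L.
           (\<forall>J\<in>C. \<forall>K\<in>C. J \<subseteq> K \<or> K \<subseteq> J) \<longrightarrow>
             I \<sqinter>\<^bsub>L\<^esub> (\<Squnion>\<^bsub>L\<^esub> C) = \<Squnion>\<^bsub>L\<^esub> ((\<lambda>J. I \<sqinter>\<^bsub>L\<^esub> J) ` C) \<and>
             I \<squnion>\<^bsub>L\<^esub> (\<Sqinter>\<^bsub>L\<^esub> C) = \<Sqinter>\<^bsub>L\<^esub> ((\<lambda>J. I \<squnion>\<^bsub>L\<^esub> J) ` C)))"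

text \<open>
  Restricting the factors to the element type of the ring loses no generality: if
  \<open>R\<close> is isomorphic to a product of rings over any types, then each factor is in
  bijection with a subset of the carrier of \<open>R\<close> (the elements corresponding to the pairs
  whose other component is zero), and its ring structure can be transported there.
\<close>
definition irreducible_ring :: "('a, 'm) ring_scheme \<Rightarrow> bool" where
  "irreducible_ring R \<longleftrightarrow> ring R \<and> carrier R \<noteq> {\<zero>\<^bsub>R\<^esub>} \<and>
     \<not> (\<exists>(S :: 'a ring) (T :: 'a ring).
           ring S \<and> carrier S \<noteq> {\<zero>\<^bsub>S\<^esub>} \<and>
           ring T \<and> carrier T \<noteq> {\<zero>\<^bsub>T\<^esub>} \<and>
           R \<simeq> RDirProd S T)"

text \<open>
  An irreducible continuous ring has exactly one rank function (von Neumann), up to the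
  irrelevant values outside the carrier; for such rings, statements about the rank
  function are therefore made for an arbitrary function satisfying this predicate.
\<close>
definition rank_function :: "('a, 'm) ring_scheme \<Rightarrow> ('a \<Rightarrow> real) \<Rightarrow> bool" where
  "rank_function R \<rho> \<longleftrightarrow>
     \<rho> \<in> carrier R \<rightarrow> {0..1} \<and>
     \<rho> \<one>\<^bsub>R\<^esub> = 1 \<and>
     (\<forall>a\<in>carrier R. \<forall>b\<in>carrier R. \<rho> (a \<otimes>\<^bsub>R\<^esub> b) \<le> min (\<rho> a) (\<rho> b)) \<and>
     (\<forall>e\<in>carrier R. \<forall>f\<in>carrier R.
        e \<otimes>\<^bsub>R\<^esub> e = e \<and> f \<otimes>\<^bsub>R\<^esub> f = f \<and>
        e \<otimes>\<^bsub>R\<^esub> f = \<zero>\<^bsub>R\<^esub> \<and> f \<otimes>\<^bsub>R\<^esub> e = \<zero>\<^bsub>R\<^esub> \<longrightarrow>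
          \<rho> (e \<oplus>\<^bsub>R\<^esub> f) = \<rho> e + \<rho> f) \<and>
     (\<forall>a\<in>carrier R. \<rho> a = 0 \<longrightarrow> a = \<zero>\<^bsub>R\<^esub>)"

text \<open>
  The value outside the carrier only serves the locale \<open>Metric_space\<close>, which demands
  symmetry and nonnegativity of the distance on the whole type.
\<close>
definition rank_metric :: "('a, 'm) ring_scheme \<Rightarrow> ('a \<Rightarrow> real) \<Rightarrow> 'a \<Rightarrow> 'a \<Rightarrow> real" where
  "rank_metric R \<rho> a b =
     (if a \<in> carrier R \<and> b \<in> carrier R then \<rho> (a \<ominus>\<^bsub>R\<^esub> b) else 0)"

definition rank_topology :: "('a, 'm) ring_scheme \<Rightarrow> ('a \<Rightarrow> real) \<Rightarrow> 'a topology" where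
  "rank_topology R \<rho> = Metric_space.mtopology (carrier R) (rank_metric R \<rho>)"

text \<open>
  A uniformity on a set \<open>M\<close> is represented, as in the class \<open>uniform_space\<close>, by a filter
  on pairs; a set \<open>E\<close> of pairs contains an entourage iff \<open>E\<close> holds eventually.
\<close>
definition metric_uniformity :: "'a set \<Rightarrow> ('a \<Rightarrow> 'a \<Rightarrow> real) \<Rightarrow> ('a \<times> 'a) filter" where
  "metric_uniformity M d =
     (INF \<epsilon>\<in>{0<..}. principal {(x, y). x \<in> M \<and> y \<in> M \<and> d x y < \<epsilon>})"

definition bourbaki_bounded :: "'a set \<Rightarrow> ('a \<times> 'a) filter \<Rightarrow> bool" where
  "bourbaki_bounded M \<U> \<longleftrightarrow>
     (\<forall>E. (\<forall>\<^sub>F p in \<U>. p \<in> E) \<longrightarrow>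
        (\<exists>(n::nat) F. finite F \<and> F \<subseteq> M \<and>
           (\<forall>y\<in>M. \<exists>x::nat \<Rightarrow> 'a.
              x 0 \<in> F \<and> x n = y \<and> (\<forall>i\<le>n. x i \<in> M) \<and>
              (\<forall>i<n. (x i, x (Suc i)) \<in> E))))"

end

theory Submission
  imports Defs
begin

text \<open>
  The finite set in the definition of boundedness is \<open>{1}\<close>: given \<open>\<epsilon>\<close>, fix a small positive rank
  \<open>3r \<le> \<epsilon>\<close> attained by an idempotent, and let \<open>g\<close> be a unit with \<open>gc = c = cg\<close> for some idempotent \<open>c\<close>
  (at first \<open>c = 0\<close>). If \<open>rk(1 - c) < 3r\<close>, then \<open>1 - g = (1 - g)(1 - c)\<close> has rank less than \<open>\<epsilon>\<close>. Otherwise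
  take an idempotent \<open>e\<close> of rank \<open>r\<close> orthogonal to \<open>c\<close>. Since \<open>eR + geR\<close> has rank at most \<open>2r\<close>, there is room
  inside \<open>(1 - c)R\<close> for an idempotent \<open>b\<close> of rank at least \<open>r\<close> independent of it. Two involutions, exchanging
  \<open>geR\<close> and \<open>eR\<close> with the same copy of \<open>eR\<close> in \<open>bR\<close>, carry \<open>ge\<close> back to \<open>e\<close>; after one more unipotent
  factor the unit fixes \<open>c + e\<close> on both sides. These three steps have size at most \<open>r\<close>, so \<open>O(1/r)\<close> of them
  suffice, independently of \<open>g\<close>.

  The copy of \<open>eR\<close> in \<open>bR\<close> comes from comparability: a principal right ideal that is maximal among those
  meeting both \<open>dR\<close> and \<open>bR\<close> trivially (Zorn, by upper continuity) contains the graph of an embedding of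
  one of \<open>dR\<close>, \<open>bR\<close> into the other, because an irreducible continuous ring is prime.
\<close>


section \<open>Idempotents of a unital ring\<close>

context ring
begin

text \<open>Right-associated normal forms hide a known product \<open>p \<otimes> q\<close> in
  \<open>p \<otimes> (q \<otimes> z)\<close>; instances of this rule make it available to
  rewriting.\<close>

lemma mult_absorb:
  assumes "p \<otimes> q = r" "p \<in> carrier R" "q \<in> carrier R" "z \<in> carrier R"
  shows "p \<otimes> (q \<otimes> z) = r \<otimes> z"
  using assms by (metis m_assoc)

definition idem :: "'a \<Rightarrow> bool" where
  "idem e \<longleftrightarrow> e \<in> carrier R \<and> e \<otimes> e = e"

lemma idemD: "idem e \<Longrightarrow> e \<in> carrier R" "idem e \<Longrightarrow> e \<otimes> e = e"
  by (auto simp: idem_def)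

lemma idem_zero: "idem \<zero>"
  by (auto simp: idem_def)

lemma idem_compl: "idem e \<Longrightarrow> idem (\<one> \<ominus> e)"
  unfolding idem_def by (auto simp: minus_eq l_distr r_distr l_minus r_minus r_neg)

lemma idem_add:
  assumes "idem e" "idem f" "e \<otimes> f = \<zero>" "f \<otimes> e = \<zero>"
  shows "idem (e \<oplus> f)"
  using assms unfolding idem_def by (auto simp: l_distr r_distr)

lemma idem_mult_compl:
  assumes "idem e"
  shows "e \<otimes> (\<one> \<ominus> e) = \<zero>" "(\<one> \<ominus> e) \<otimes> e = \<zero>"
  using assms unfolding idem_def by (auto simp: minus_eq l_distr r_distr l_minus r_minus r_neg)

end

section \<open>Rank functions on regular rings and the rank metric\<close>

locale rank_ring = ring R
  for R :: "('a, 'm) ring_scheme" (structure) and rk :: "'a \<Rightarrow> real" +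
  assumes regular: "a \<in> carrier R \<Longrightarrow> \<exists>b\<in>carrier R. a \<otimes> b \<otimes> a = a"
    and rank: "rank_function R rk"
begin

lemma rk_one: "rk \<one> = 1"
  using rank by (simp add: rank_function_def)

lemma rk_nonneg: "a \<in> carrier R \<Longrightarrow> 0 \<le> rk a"
  using rank by (auto simp: rank_function_def Pi_iff)

lemma rk_mult_le:
  assumes "a \<in> carrier R" "b \<in> carrier R"
  shows "rk (a \<otimes> b) \<le> rk a" "rk (a \<otimes> b) \<le> rk b"
  using rank assms by (auto simp: rank_function_def)

lemma rk_eq_0: "a \<in> carrier R \<Longrightarrow> rk a = 0 \<Longrightarrow> a = \<zero>"
  using rank by (auto simp: rank_function_def)

lemma rk_add_orth:
  assumes "idem e" "idem f" "e \<otimes> f = \<zero>" "f \<otimes> e = \<zero>"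
  shows "rk (e \<oplus> f) = rk e + rk f"
  using rank assms unfolding rank_function_def idem_def by blast

lemma rk_zero: "rk \<zero> = 0"
  using rk_add_orth[OF idem_zero idem_zero] by simp

lemma rk_compl: assumes "idem e" shows "rk (\<one> \<ominus> e) = 1 - rk e"
proof -
  have "e \<oplus> (\<one> \<ominus> e) = \<one>"
    using idemD(1)[OF assms] by algebra
  then show ?thesis
    using rk_add_orth[OF assms idem_compl[OF assms] idem_mult_compl[OF assms]] rk_one by simp
qed

lemma rk_diff_idem:
  assumes e: "idem e" and f: "idem f" and ef: "e \<otimes> f = f" "f \<otimes> e = f"
  shows "idem (e \<ominus> f)" "rk (e \<ominus> f) = rk e - rk f"
proof -
  note c = idemD(1)[OF e] idemD(1)[OF f]
  show i: "idem (e \<ominus> f)"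
    using assms unfolding idem_def
    by (auto simp: minus_eq l_distr r_distr l_minus r_minus r_neg)
  have "f \<otimes> (e \<ominus> f) = \<zero>" "(e \<ominus> f) \<otimes> f = \<zero>"
    using assms unfolding idem_def by (auto simp: minus_eq l_distr r_distr l_minus r_minus r_neg)
  moreover have "f \<oplus> (e \<ominus> f) = e"
    using c by algebra
  ultimately show "rk (e \<ominus> f) = rk e - rk f"
    using rk_add_orth[OF f i] by simp
qed

lemma rk_uminus: assumes "a \<in> carrier R" shows "rk (\<ominus> a) = rk a"
proof -
  have "rk (\<ominus> b) \<le> rk b" if "b \<in> carrier R" for b
    using rk_mult_le(1)[of b "\<ominus> \<one>"] that by (simp add: r_minus)
  from this[of a] this[of "\<ominus> a"] show ?thesis using assms by simp
qed

lemma rk_unit_mult: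
  assumes "u \<in> Units R" "a \<in> carrier R"
  shows "rk (u \<otimes> a) = rk a" "rk (a \<otimes> u) = rk a"
proof -
  have c: "u \<in> carrier R" "inv u \<in> carrier R"
    using assms by auto
  have "inv u \<otimes> (u \<otimes> a) = a" "a \<otimes> u \<otimes> inv u = a"
    using assms c by (metis Units_l_inv m_assoc l_one, metis Units_r_inv m_assoc r_one)
  then show "rk (u \<otimes> a) = rk a" "rk (a \<otimes> u) = rk a"
    using rk_mult_le[of u a] rk_mult_le[of a u] rk_mult_le[of "inv u" "u \<otimes> a"]
      rk_mult_le[of "a \<otimes> u" "inv u"] assms c by auto
qed

lemma quasi_inverse:
  assumes "a \<in> carrier R"
  obtains b where "b \<in> carrier R" "a \<otimes> b \<otimes> a = a" "idem (a \<otimes> b)" "idem (b \<otimes> a)"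
    "rk (a \<otimes> b) = rk a" "rk (b \<otimes> a) = rk a"
proof -
  obtain b where b: "b \<in> carrier R" "a \<otimes> b \<otimes> a = a"
    using regular assms by blast
  have i: "idem (a \<otimes> b)"
    unfolding idem_def using b assms m_assoc[of "a \<otimes> b" a b] by auto
  have j: "idem (b \<otimes> a)"
    unfolding idem_def using b assms by (auto simp: m_assoc)
  have "rk (a \<otimes> b) = rk a" "rk (b \<otimes> a) = rk a"
    using rk_mult_le[of a b] rk_mult_le[of b a] rk_mult_le[of "a \<otimes> b" a] rk_mult_le[of a "b \<otimes> a"] b assms
    by (auto simp: m_assoc)
  with that b i j show ?thesis by blast
qed

text \<open>The join \<open>pR + bR\<close> is generated by an idempotent
  \<open>p \<oplus> u\<close>, where \<open>u\<close> is orthogonal to \<open>p\<close> and accounts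
  for the part \<open>(1 - p)b\<close> of \<open>b\<close>; hence the rank bound. The elements
  \<open>s\<close> and \<open>t\<close> record that \<open>q\<close> lies in the sum.\<close>

lemma join_idem:
  assumes p: "idem p" and b: "b \<in> carrier R"
  obtains q s t where "idem q" "q \<otimes> p = p" "p \<otimes> q = p" "q \<otimes> b = b" "rk q \<le> rk p + rk b"
    "s \<in> carrier R" "t \<in> carrier R" "q = p \<otimes> s \<oplus> b \<otimes> t"
proof -
  note pc = idemD[OF p]
  define c where "c = (\<one> \<ominus> p) \<otimes> b"
  have c: "c \<in> carrier R" using pc b by (simp add: c_def)
  have pcz: "p \<otimes> c = \<zero>"
    using idem_mult_compl(1)[OF p] pc b by (simp add: c_def m_assoc[symmetric])
  obtain c' where c': "c' \<in> carrier R" "c \<otimes> c' \<otimes> c = c" and v: "idem (c \<otimes> c')"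
    using quasi_inverse[OF c] by metis
  define v where "v = c \<otimes> c'"
  have vc: "v \<in> carrier R" "v \<otimes> v = v" "v \<otimes> c = c"
    using v c c' by (auto simp: v_def idem_def)
  have pv: "p \<otimes> v = \<zero>"
    using pcz c c' pc by (simp add: v_def m_assoc[symmetric])
  \<comment> \<open>The idempotent \<open>v\<close> generates \<open>cR\<close>, but only
    \<open>pv = 0\<close> is known; the factor \<open>1 - p\<close> makes the product with
    \<open>p\<close> vanish in the other order too.\<close>
  define u where "u = v \<otimes> (\<one> \<ominus> p)"
  have uc: "u \<in> carrier R" using vc pc by (simp add: u_def)
  have up: "u \<otimes> p = \<zero>"
    using idem_mult_compl(2)[OF p] pc vc by (simp add: u_def m_assoc)
  have pu: "p \<otimes> u = \<zero>"
    using pv pc vc by (simp add: u_def m_assoc[symmetric])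
  have u': "u = v \<ominus> v \<otimes> p"
    using pc vc by (simp add: u_def minus_eq r_distr r_minus)
  have uv: "u \<otimes> v = v"
    using pc vc pv by (simp add: u' minus_eq l_distr l_minus m_assoc)
  have "u \<otimes> u = u"
    using uv pc vc uc by (metis u_def m_assoc minus_closed one_closed)
  then have ui: "idem u" using uc by (simp add: idem_def)
  have "u \<otimes> c = u \<otimes> v \<otimes> c" using vc uc c by (simp add: m_assoc)
  then have ucc: "u \<otimes> c = c" using uv vc by simp
  have b': "b = p \<otimes> b \<oplus> c"
    using pc b by (simp add: c_def) algebra
  have pq: "idem (p \<oplus> u)" using idem_add[OF p ui pu up] .
  have qp: "(p \<oplus> u) \<otimes> p = p" "p \<otimes> (p \<oplus> u) = p"
    using pc uc up pu by (auto simp: l_distr r_distr)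
  have "(p \<oplus> u) \<otimes> (p \<otimes> b \<oplus> c) = p \<otimes> b \<oplus> c"
    using pc uc c b pcz up ucc
    by (simp add: l_distr r_distr mult_absorb[OF up] mult_absorb[OF pc(2)])
  then have qb: "(p \<oplus> u) \<otimes> b = b" using b' by simp
  have "rk u \<le> rk v" "rk v \<le> rk c" "rk c \<le> rk b"
    using rk_mult_le vc pc c c' b by (auto simp: u_def v_def c_def)
  then have rk: "rk (p \<oplus> u) \<le> rk p + rk b"
    using rk_add_orth[OF p ui pu up] by simp
  define t where "t = c' \<otimes> (\<one> \<ominus> p)"
  have t: "t \<in> carrier R" using c' pc by (simp add: t_def)
  have "u = c \<otimes> t" using c' pc c by (simp add: u_def v_def t_def m_assoc)
  also have "\<dots> = b \<otimes> t \<ominus> p \<otimes> (b \<otimes> t)"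
    using b t pc by (simp add: c_def minus_eq l_distr l_minus m_assoc)
  finally have "p \<oplus> u = p \<otimes> (\<one> \<ominus> b \<otimes> t) \<oplus> b \<otimes> t"
    using pc b t by (simp add: minus_eq r_distr r_minus a_ac)
  then show ?thesis
    using that[OF pq qp qb rk _ t, of "\<one> \<ominus> b \<otimes> t"] b t by simp
qed

lemma rk_add_le:
  assumes "a \<in> carrier R" "b \<in> carrier R"
  shows "rk (a \<oplus> b) \<le> rk a + rk b"
proof -
  obtain a' where a': "a' \<in> carrier R" "a \<otimes> a' \<otimes> a = a" "idem (a \<otimes> a')" "rk (a \<otimes> a') = rk a"
    using quasi_inverse[OF assms(1)] by metis
  obtain q where q: "idem q" "q \<otimes> (a \<otimes> a') = a \<otimes> a'" "q \<otimes> b = b" "rk q \<le> rk (a \<otimes> a') + rk b"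
    using join_idem[OF a'(3) assms(2)] by metis
  note qc = idemD(1)[OF q(1)]
  have "q \<otimes> a = a"
    using q(2) a' assms qc by (metis m_assoc m_closed)
  then have "q \<otimes> (a \<oplus> b) = a \<oplus> b"
    using q assms qc by (simp add: r_distr)
  then show ?thesis
    using rk_mult_le(1)[of q "a \<oplus> b"] q(4) a'(4) assms qc by simp
qed

lemma rk_minus_commute:
  assumes "a \<in> carrier R" "b \<in> carrier R"
  shows "rk (a \<ominus> b) = rk (b \<ominus> a)"
proof -
  have "\<ominus> (b \<ominus> a) = a \<ominus> b" using assms by algebra
  then show ?thesis using rk_uminus[of "b \<ominus> a"] assms by simp
qed

lemma Metric_space_rank_metric: "Metric_space (carrier R) (rank_metric R rk)"
proof
  show "0 \<le> rank_metric R rk x y" for x y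
    by (simp add: rank_metric_def rk_nonneg)
  show "rank_metric R rk x y = rank_metric R rk y x" for x y
    by (simp add: rank_metric_def rk_minus_commute)
  show "rank_metric R rk x y = 0 \<longleftrightarrow> x = y" if "x \<in> carrier R" "y \<in> carrier R" for x y
    using that rk_eq_0[of "x \<ominus> y"] by (auto simp: rank_metric_def rk_zero r_neg minus_eq[of y y])
  show "rank_metric R rk x z \<le> rank_metric R rk x y + rank_metric R rk y z"
    if "x \<in> carrier R" "y \<in> carrier R" "z \<in> carrier R" for x y z
  proof -
    have "x \<ominus> z = (x \<ominus> y) \<oplus> (y \<ominus> z)" using that by algebra
    then show ?thesis
      using that rk_add_le[of "x \<ominus> y" "y \<ominus> z"] by (simp add: rank_metric_def)
  qed
qed

text \<open>If all nonzero elements had rank at least \<open>\<epsilon>\<close>, balls of radius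
  \<open>\<epsilon>\<close> would be singletons or empty. Regularity replaces a nonzero element of
  small rank by an idempotent of the same rank.\<close>

lemma nondiscrete_small_rank:
  assumes "rank_topology R rk \<noteq> discrete_topology (carrier R)" and "0 < \<epsilon>"
  obtains e where "idem e" "e \<noteq> \<zero>" "rk e < \<epsilon>"
proof -
  interpret M: Metric_space "carrier R" "rank_metric R rk"
    by (rule Metric_space_rank_metric)
  have "\<exists>a\<in>carrier R. a \<noteq> \<zero> \<and> rk a < \<epsilon>"
  proof (rule ccontr)
    assume no: "\<not> ?thesis"
    have "M.mball x \<epsilon> \<subseteq> {x}" for x
    proof
      fix y assume "y \<in> M.mball x \<epsilon>"
      then have xy: "x \<in> carrier R" "y \<in> carrier R" "rk (x \<ominus> y) < \<epsilon>"
        by (auto simp: rank_metric_def)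
      then have "x \<ominus> y = \<zero>" using no by (metis minus_closed)
      then show "y \<in> {x}" using xy by simp
    qed
    then have "openin M.mtopology U" if "U \<subseteq> carrier R" for U
      using that \<open>0 < \<epsilon>\<close> unfolding M.openin_mtopology by blast
    then have "M.mtopology = discrete_topology (carrier R)"
      using discrete_topology_unique[of "carrier R" M.mtopology] by auto
    then show False using assms by (simp add: rank_topology_def)
  qed
  then obtain a where a: "a \<in> carrier R" "a \<noteq> \<zero>" "rk a < \<epsilon>" by blast
  obtain b where b: "b \<in> carrier R" "a \<otimes> b \<otimes> a = a" "idem (a \<otimes> b)" "rk (a \<otimes> b) = rk a"
    using quasi_inverse[OF a(1)] by metis
  then have "a \<otimes> b \<noteq> \<zero>" using a by auto
  then show ?thesis using that a b by metis
qed

end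

section \<open>Principal right ideals: suprema, central idempotents and primeness\<close>

abbreviation (in ring) rideal :: "'a \<Rightarrow> 'a set" where
  "rideal a \<equiv> a <# carrier R"

lemma (in ring) mem_rideal_iff: "x \<in> rideal a \<longleftrightarrow> (\<exists>r\<in>carrier R. x = a \<otimes> r)"
  by (auto simp: l_coset_def)

locale irreducible_continuous_rank_ring = rank_ring +
  assumes continuous: "continuous_ring R" and irreducible: "irreducible_ring R"
begin

abbreviation L where "L \<equiv> principal_right_ideals R"

lemma complete_lattice_L: "complete_lattice L"
  using continuous by (simp add: continuous_ring_def Let_def)

lemma in_carrier_L: "a \<in> carrier R \<Longrightarrow> rideal a \<in> carrier L"
  by (auto simp: principal_right_ideals_def)

lemma le_L: "I \<sqsubseteq>\<^bsub>L\<^esub> J \<longleftrightarrow> I \<subseteq> J"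
  by (simp add: principal_right_ideals_def)

lemma carrier_LE:
  assumes "I \<in> carrier L"
  obtains a where "a \<in> carrier R" "I = rideal a"
  using assms by (auto simp: principal_right_ideals_def)

lemma rideal_subset_of_mem:
  assumes "I \<in> carrier L" "x \<in> I"
  shows "x \<in> carrier R" "rideal x \<subseteq> I"
  using assms by (auto elim!: carrier_LE simp: mem_rideal_iff m_assoc) (metis m_closed)

lemma mem_rideal_self: "x \<in> carrier R \<Longrightarrow> x \<in> rideal x"
  using mem_rideal_iff[of x x] r_one[of x] one_closed by metis

lemma rideal_zero: "rideal \<zero> = {\<zero>}"
  by (auto simp: mem_rideal_iff) (use zero_closed in blast)

lemma zero_mem: "I \<in> carrier L \<Longrightarrow> \<zero> \<in> I"
  by (auto elim!: carrier_LE simp: mem_rideal_iff) (metis r_null zero_closed)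

text \<open>Upper continuity distributes the meet with \<open>I\<close> over the chain, and every
  resulting meet is zero. This supplies the upper bounds for Zorn's lemma.\<close>

lemma chain_upper_bound_disjoint:
  assumes C: "C \<subseteq> carrier L" and chain: "\<forall>J\<in>C. \<forall>K\<in>C. J \<subseteq> K \<or> K \<subseteq> J"
  obtains K where "K \<in> carrier L" "\<And>J. J \<in> C \<Longrightarrow> J \<subseteq> K"
    "\<And>I. I \<in> carrier L \<Longrightarrow> (\<And>J. J \<in> C \<Longrightarrow> I \<inter> J = {\<zero>}) \<Longrightarrow> I \<inter> K = {\<zero>}"
proof -
  interpret L: complete_lattice L by (rule complete_lattice_L)
  let ?K = "\<Squnion>\<^bsub>L\<^esub> C"
  have K: "?K \<in> carrier L" using C by simp
  have ub: "J \<subseteq> ?K" if "J \<in> C" for J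
    using L.sup_upper[of C J] C that by (auto simp: le_L)
  have "I \<inter> ?K = {\<zero>}" if I: "I \<in> carrier L" and dis: "\<And>J. J \<in> C \<Longrightarrow> I \<inter> J = {\<zero>}" for I
  proof -
    let ?M = "(\<lambda>J. I \<sqinter>\<^bsub>L\<^esub> J) ` C"
    have "I \<sqinter>\<^bsub>L\<^esub> ?K = \<Squnion>\<^bsub>L\<^esub> ?M"
      using continuous C I chain by (simp add: continuous_ring_def Let_def)
    moreover have "\<Squnion>\<^bsub>L\<^esub> ?M \<sqsubseteq>\<^bsub>L\<^esub> {\<zero>}"
    proof (rule L.sup_least)
      show "?M \<subseteq> carrier L" using C I by auto
      show "{\<zero>} \<in> carrier L" using in_carrier_L[of \<zero>] rideal_zero by simp
      show "M \<sqsubseteq>\<^bsub>L\<^esub> {\<zero>}" if M: "M \<in> ?M" for M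
      proof -
        obtain J where J: "J \<in> C" "M = I \<sqinter>\<^bsub>L\<^esub> J" using M by blast
        have "M \<subseteq> I" "M \<subseteq> J"
          using L.meet_left[of I J] L.meet_right[of I J] I J C by (auto simp: le_L)
        then show ?thesis using dis[OF J(1)] by (auto simp: le_L)
      qed
    qed
    ultimately have le: "I \<sqinter>\<^bsub>L\<^esub> ?K \<subseteq> {\<zero>}" by (simp add: le_L)
    \<comment> \<open>The lattice meet is compared with the intersection through elements: a common
      \<open>x\<close> generates a principal right ideal below both, hence below the meet.\<close>
    have "x = \<zero>" if x: "x \<in> I" "x \<in> ?K" for x
    proof -
      note xc = rideal_subset_of_mem[OF I x(1)] rideal_subset_of_mem[OF K x(2)]
      have "rideal x \<sqsubseteq>\<^bsub>L\<^esub> I \<sqinter>\<^bsub>L\<^esub> ?K"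
        using xc by (intro L.meet_le) (auto simp: le_L in_carrier_L I K)
      then show ?thesis using le mem_rideal_self[OF xc(1)] by (auto simp: le_L)
    qed
    then show ?thesis using zero_mem[OF I] zero_mem[OF K] by blast
  qed
  with that K ub show ?thesis by blast
qed

text \<open>The generator \<open>h\<close> of the lattice supremum is described by elements, so that
  it can be compared directly with annihilators.\<close>

lemma sup_of_set:
  assumes "A \<subseteq> carrier R"
  obtains h where "h \<in> carrier R" "\<And>a. a \<in> A \<Longrightarrow> a \<in> rideal h"
    "\<And>k. k \<in> carrier R \<Longrightarrow> (\<And>a. a \<in> A \<Longrightarrow> a \<in> rideal k) \<Longrightarrow> h \<in> rideal k"
proof -
  interpret L: complete_lattice L by (rule complete_lattice_L)
  let ?C = "(\<lambda>a. rideal a) ` A"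
  have C: "?C \<subseteq> carrier L" using assms in_carrier_L by blast
  then have K: "\<Squnion>\<^bsub>L\<^esub> ?C \<in> carrier L" by (rule L.sup_closed)
  then obtain h where h: "h \<in> carrier R" "\<Squnion>\<^bsub>L\<^esub> ?C = rideal h"
    using carrier_LE by blast
  have "a \<in> rideal h" if "a \<in> A" for a
    using L.sup_upper[OF C, of "rideal a"] that mem_rideal_self[of a] assms h by (auto simp: le_L)
  moreover have "h \<in> rideal k"
    if k: "k \<in> carrier R" and a: "\<And>a. a \<in> A \<Longrightarrow> a \<in> rideal k" for k
  proof -
    have "\<Squnion>\<^bsub>L\<^esub> ?C \<sqsubseteq>\<^bsub>L\<^esub> rideal k"
      using rideal_subset_of_mem(2)[OF in_carrier_L[OF k]] a
      by (intro L.sup_least C in_carrier_L k) (auto simp: le_L)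
    then show ?thesis using mem_rideal_self h by (auto simp: le_L)
  qed
  ultimately show ?thesis using that h(1) by blast
qed

text \<open>A central idempotent \<open>h\<close> splits \<open>R\<close> as the product of
  \<open>hR\<close> and \<open>(1 - h)R\<close>; if it were neither zero nor one, both factors would
  be nonzero, against irreducibility.\<close>

lemma central_idem_trivial:
  assumes h: "idem h" and central: "\<And>r. r \<in> carrier R \<Longrightarrow> r \<otimes> h = h \<otimes> r"
  shows "h = \<zero> \<or> h = \<one>"
proof (rule ccontr)
  assume neg: "\<not> ?thesis"
  \<comment> \<open>For a central idempotent \<open>f\<close>, the set \<open>fR\<close> is a ring
    with unit \<open>f\<close> under the operations of \<open>R\<close>. It keeps the element type
    \<open>'a\<close>, as \<open>irreducible_ring\<close> demands of the factors.\<close>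
  define corner :: "'a \<Rightarrow> 'a ring" where
    "corner f = \<lparr>carrier = rideal f, mult = mult R, one = f, ring.zero = \<zero>, ring.add = add R\<rparr>" for f
  have ring_corner: "ring (corner f)" and corner_nz: "f \<noteq> \<zero> \<Longrightarrow> carrier (corner f) \<noteq> {\<zero>\<^bsub>corner f\<^esub>}"
    and corner_mem: "\<And>x. x \<in> carrier (corner f) \<longleftrightarrow> x \<in> carrier R \<and> f \<otimes> x = x"
    if f: "idem f" and fc: "\<And>r. r \<in> carrier R \<Longrightarrow> r \<otimes> f = f \<otimes> r" for f
  proof -
    note fD = idemD[OF f]
    show mem: "x \<in> carrier (corner f) \<longleftrightarrow> x \<in> carrier R \<and> f \<otimes> x = x" for x
      using fD by (auto simp: corner_def mem_rideal_iff m_assoc[symmetric]) metis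
    show "ring (corner f)"
    proof (rule ringI)
      show "abelian_group (corner f)"
      proof (rule abelian_groupI)
        show "\<exists>y\<in>carrier (corner f). y \<oplus>\<^bsub>corner f\<^esub> x = \<zero>\<^bsub>corner f\<^esub>" if "x \<in> carrier (corner f)" for x
          using that fD unfolding mem by (intro bexI[of _ "\<ominus> x"]) (auto simp: mem l_neg r_minus, simp add: corner_def l_neg)
      qed (use fD in \<open>auto simp: mem\<close>, auto simp: corner_def a_ac r_distr)
      show "monoid (corner f)"
      proof (rule monoidI)
        show "x \<otimes>\<^bsub>corner f\<^esub> y \<in> carrier (corner f)" if "x \<in> carrier (corner f)" "y \<in> carrier (corner f)" for x y
          using that fD m_assoc[of f x y] unfolding mem by (simp add: corner_def)
        show "x \<otimes>\<^bsub>corner f\<^esub> \<one>\<^bsub>corner f\<^esub> = x" if "x \<in> carrier (corner f)" for x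
          using that fD fc[of x] unfolding mem by (simp add: corner_def)
      qed (use fD in \<open>auto simp: mem\<close>, auto simp: corner_def m_assoc)
    qed (use fD in \<open>auto simp: mem\<close>, auto simp: corner_def l_distr r_distr)
    show "carrier (corner f) \<noteq> {\<zero>\<^bsub>corner f\<^esub>}" if "f \<noteq> \<zero>"
      using that fD mem by (auto simp: corner_def)
  qed
  let ?k = "\<one> \<ominus> h"
  note hD = idemD[OF h] and k = idem_compl[OF h] and kh = idem_mult_compl[OF h]
  note kD = idemD[OF k]
  have kcen: "r \<otimes> ?k = ?k \<otimes> r" if "r \<in> carrier R" for r
    using that central[OF that] hD by (simp add: minus_eq l_distr r_distr l_minus r_minus)
  have "?k \<noteq> \<zero>" using neg hD by auto
  have "(\<lambda>x. (h \<otimes> x, ?k \<otimes> x)) \<in> ring_iso R (RDirProd (corner h) (corner ?k))"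
  proof (rule ring_iso_memI)
    show "bij_betw (\<lambda>x. (h \<otimes> x, ?k \<otimes> x)) (carrier R) (carrier (RDirProd (corner h) (corner ?k)))"
    proof (rule bij_betw_byWitness[where f' = "\<lambda>(x, y). x \<oplus> y"])
      show "\<forall>x\<in>carrier R. (case (h \<otimes> x, ?k \<otimes> x) of (x, y) \<Rightarrow> x \<oplus> y) = x"
      proof
        fix x assume "x \<in> carrier R"
        then have "h \<otimes> x \<oplus> ?k \<otimes> x = x" using hD(1) by algebra
        then show "(case (h \<otimes> x, ?k \<otimes> x) of (x, y) \<Rightarrow> x \<oplus> y) = x" by simp
      qed
      have "h \<otimes> (x \<oplus> y) = x" "?k \<otimes> (x \<oplus> y) = y"
        if xy: "x \<in> carrier R" "y \<in> carrier R" "h \<otimes> x = x" "?k \<otimes> y = y" for x y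
      proof -
        have "h \<otimes> y = \<zero>" "?k \<otimes> x = \<zero>"
          using kh hD kD xy mult_absorb[OF kh(1), of y] mult_absorb[OF kh(2), of x] by auto
        then show "h \<otimes> (x \<oplus> y) = x" "?k \<otimes> (x \<oplus> y) = y"
          using xy hD kD by (simp_all add: r_distr)
      qed
      then show "\<forall>z\<in>carrier (RDirProd (corner h) (corner ?k)).
          (h \<otimes> (case z of (x, y) \<Rightarrow> x \<oplus> y), ?k \<otimes> (case z of (x, y) \<Rightarrow> x \<oplus> y)) = z"
        using corner_mem[OF h central] corner_mem[OF k kcen] by (auto simp: RDirProd_carrier)
      show "(\<lambda>x. (h \<otimes> x, ?k \<otimes> x)) ` carrier R \<subseteq> carrier (RDirProd (corner h) (corner ?k))"
        using corner_mem[OF h central] corner_mem[OF k kcen] hD kD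
        by (auto simp: RDirProd_carrier m_assoc[symmetric])
      show "(\<lambda>(x, y). x \<oplus> y) ` carrier (RDirProd (corner h) (corner ?k)) \<subseteq> carrier R"
        using corner_mem[OF h central] corner_mem[OF k kcen] by (auto simp: RDirProd_carrier)
    qed
    have mult: "f \<otimes> (x \<otimes> y) = f \<otimes> x \<otimes> (f \<otimes> y)"
      if "idem f" "\<And>r. r \<in> carrier R \<Longrightarrow> r \<otimes> f = f \<otimes> r" "x \<in> carrier R" "y \<in> carrier R" for f x y
    proof -
      have "f \<otimes> x \<otimes> (f \<otimes> y) = f \<otimes> (x \<otimes> f) \<otimes> y" using idemD[OF that(1)] that(3,4) by (simp add: m_assoc)
      also have "\<dots> = f \<otimes> f \<otimes> x \<otimes> y"
        using that(2)[OF that(3)] idemD(1)[OF that(1)] that(3,4) by (simp add: m_assoc)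
      finally show ?thesis using idemD[OF that(1)] that(3,4) by (simp add: m_assoc)
    qed
    show "(h \<otimes> (x \<otimes> y), ?k \<otimes> (x \<otimes> y)) =
        (h \<otimes> x, ?k \<otimes> x) \<otimes>\<^bsub>RDirProd (corner h) (corner ?k)\<^esub> (h \<otimes> y, ?k \<otimes> y)"
      if "x \<in> carrier R" "y \<in> carrier R" for x y
      using mult[OF h central that] mult[OF k kcen that]
      by (simp add: RDirProd_def DirProd_def monoid.defs corner_def)
  qed (use hD kD in \<open>auto simp: RDirProd_def DirProd_def monoid.defs corner_def r_distr
        mem_rideal_iff\<close>)
  then have "R \<simeq> RDirProd (corner h) (corner ?k)"
    by (auto simp: is_ring_iso_def)
  then show False
    using irreducible ring_corner[OF h central] corner_nz[OF h central]
      ring_corner[OF k kcen] corner_nz[OF k kcen] neg \<open>?k \<noteq> \<zero>\<close>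
    unfolding irreducible_ring_def by blast
qed

text \<open>The elements \<open>x\<close> with \<open>eRx = 0\<close> form a two-sided ideal
  \<open>J\<close>. Completeness makes it a principal right ideal, so an idempotent \<open>h\<close>
  generates it; being two-sided then makes \<open>h\<close> central. So \<open>h\<close> is zero or
  one, which forces \<open>f = 0\<close> or \<open>e = 0\<close> respectively.\<close>

lemma prime:
  assumes e: "idem e" and f: "f \<in> carrier R"
    and ef: "\<And>r. r \<in> carrier R \<Longrightarrow> e \<otimes> r \<otimes> f = \<zero>"
  shows "e = \<zero> \<or> f = \<zero>"
proof -
  note eD = idemD[OF e]
  define J where "J = {x \<in> carrier R. \<forall>r\<in>carrier R. e \<otimes> r \<otimes> x = \<zero>}"
  obtain h0 where h0: "h0 \<in> carrier R" "\<And>a. a \<in> J \<Longrightarrow> a \<in> rideal h0"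
    "\<And>k. k \<in> carrier R \<Longrightarrow> (\<And>a. a \<in> J \<Longrightarrow> a \<in> rideal k) \<Longrightarrow> h0 \<in> rideal k"
    using sup_of_set[of J] by (auto simp: J_def)
  \<comment> \<open>Annihilators are principal, so the supremum of the principal right ideals inside \<open>J\<close> lies in \<open>J\<close>.\<close>
  have h0J: "h0 \<in> J"
  proof -
    have "e \<otimes> r \<otimes> h0 = \<zero>" if r: "r \<in> carrier R" for r
    proof -
      define c where "c = e \<otimes> r"
      have c: "c \<in> carrier R" using eD r by (simp add: c_def)
      obtain c' where c': "c' \<in> carrier R" "c \<otimes> c' \<otimes> c = c" using regular[OF c] by blast
      define k where "k = \<one> \<ominus> c' \<otimes> c"
      have k: "k \<in> carrier R" using c c' by (simp add: k_def)
      have ck: "c \<otimes> k = \<zero>" using c c' by (simp add: k_def minus_eq r_distr r_minus m_assoc[symmetric] r_neg)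
      have "a \<in> rideal k" if "a \<in> J" for a
      proof -
        have a: "a \<in> carrier R" "c \<otimes> a = \<zero>" using that r by (auto simp: J_def c_def)
        have "a = k \<otimes> a" using a c c' by (simp add: k_def minus_eq l_distr l_minus m_assoc)
        then show ?thesis using a(1) mem_rideal_iff by blast
      qed
      then obtain s where "s \<in> carrier R" "h0 = k \<otimes> s" using h0(3)[OF k] mem_rideal_iff by blast
      then show ?thesis using ck c k by (simp add: c_def[symmetric] m_assoc[symmetric])
    qed
    then show ?thesis using h0 by (simp add: J_def)
  qed
  obtain h' where h': "h' \<in> carrier R" "h0 \<otimes> h' \<otimes> h0 = h0" "idem (h0 \<otimes> h')"
    using quasi_inverse[OF h0(1)] by metis
  define h where "h = h0 \<otimes> h'"
  have h: "idem h" using h' by (simp add: h_def)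
  note hD = idemD[OF h]
  have Jl: "r \<otimes> x \<in> J" if "r \<in> carrier R" "x \<in> J" for r x
    using that eD by (auto simp: J_def m_assoc[symmetric]) (metis m_assoc m_closed)
  have Jr: "x \<otimes> r \<in> J" if "r \<in> carrier R" "x \<in> J" for r x
    using that eD by (auto simp: J_def m_assoc[symmetric])
  have hJ: "h \<in> J" using Jr[OF h'(1) h0J] by (simp add: h_def)
  have hx: "h \<otimes> x = x" if x: "x \<in> J" for x
  proof -
    obtain s where "s \<in> carrier R" "x = h0 \<otimes> s" using h0(2)[OF x] mem_rideal_iff by blast
    then show ?thesis using h' h0(1) by (simp add: h_def m_assoc[symmetric])
  qed
  have hrh: "h \<otimes> (r \<otimes> h) = r \<otimes> h" if "r \<in> carrier R" for r
    using hx[OF Jl[OF that hJ]] .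
  have central: "r \<otimes> h = h \<otimes> r" if r: "r \<in> carrier R" for r
  proof -
    \<comment> \<open>From \<open>hrh = rh\<close> follow \<open>hz = z\<close> and
      \<open>zh = 0\<close>. Inserting \<open>h\<close> into \<open>zz'z\<close>, which equals
      \<open>z\<close>, then gives \<open>z = 0\<close>.\<close>
    define z where "z = h \<otimes> r \<ominus> r \<otimes> h"
    have z: "z \<in> carrier R" using hD r by (simp add: z_def)
    have hz: "h \<otimes> z = z" using hD r hrh[OF r]
      by (simp add: z_def minus_eq r_distr r_minus m_assoc[symmetric])
    have zh: "z \<otimes> h = \<zero>" using hD r hrh[OF r]
      by (simp add: z_def minus_eq l_distr l_minus m_assoc r_neg)
    obtain z' where z': "z' \<in> carrier R" "z \<otimes> z' \<otimes> z = z" using regular[OF z] by blast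
    have "z \<otimes> z' \<otimes> z = z \<otimes> (z' \<otimes> h) \<otimes> z" using hz z z' hD by (simp add: m_assoc)
    also have "\<dots> = z \<otimes> h \<otimes> (z' \<otimes> h) \<otimes> z" using hrh[OF z'(1)] z z' hD by (simp add: m_assoc)
    finally have "z = \<zero>" using zh z z' hD by simp
    then show ?thesis using hD r by (simp add: z_def)
  qed
  from central_idem_trivial[OF h central] show ?thesis
  proof
    assume "h = \<zero>"
    moreover have "f \<in> J" using f ef by (simp add: J_def)
    ultimately show ?thesis using hx[of f] f by simp
  next
    assume "h = \<one>"
    then have "e \<otimes> \<one> \<otimes> \<one> = \<zero>" using hJ unfolding J_def by blast
    then show ?thesis using eD by simp
  qed
qed

end

section \<open>Comparability of idempotents\<close>

context rank_ring
begin

text \<open>Left multiplication by \<open>x = bsd\<close> takes the component in \<open>bR\<close>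
  of an element of \<open>dR\<close>. A kernel element would lie in \<open>gR\<close>, so the map is
  injective on \<open>dR\<close>, and a quasi-inverse yields its left inverse \<open>y\<close>. The
  pair presents \<open>dR\<close> as isomorphic to a direct summand of \<open>bR\<close>.\<close>

lemma embedding_of_graph:
  assumes d: "idem d" and b: "idem b" and g: "g \<in> carrier R"
    and dis: "rideal d \<inter> rideal g = {\<zero>}"
    and s: "s \<in> carrier R" and t: "t \<in> carrier R" and eq: "d = b \<otimes> s \<oplus> g \<otimes> t"
  obtains x y where "x \<in> carrier R" "y \<in> carrier R" "b \<otimes> x = x" "x \<otimes> d = x"
    "d \<otimes> y = y" "y \<otimes> b = y" "y \<otimes> x = d"
proof -
  note dD = idemD[OF d] and bD = idemD[OF b]
  define x where "x = b \<otimes> s \<otimes> d"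
  have x: "x \<in> carrier R" "b \<otimes> x = x" "x \<otimes> d = x"
    using bD dD s by (simp_all add: x_def m_assoc mult_absorb[OF bD(2)])
  have inj: "d \<otimes> r = \<zero>" if r: "r \<in> carrier R" and xr: "x \<otimes> r = \<zero>" for r
  proof -
    have "d \<otimes> r = d \<otimes> (d \<otimes> r)" using dD r by (simp add: mult_absorb[OF dD(2)])
    also have "\<dots> = (b \<otimes> s \<oplus> g \<otimes> t) \<otimes> (d \<otimes> r)" using eq by simp
    also have "\<dots> = x \<otimes> r \<oplus> g \<otimes> (t \<otimes> (d \<otimes> r))"
      using bD(1) dD(1) s t g r by (simp add: x_def l_distr m_assoc)
    finally have "d \<otimes> r = g \<otimes> (t \<otimes> (d \<otimes> r))" using xr g t dD(1) r by simp
    then have "d \<otimes> r \<in> rideal d \<inter> rideal g"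
      using t dD(1) r unfolding mem_rideal_iff Int_iff by (metis m_closed)
    then show ?thesis using dis by blast
  qed
  obtain y' where y': "y' \<in> carrier R" "x \<otimes> y' \<otimes> x = x" using regular[OF x(1)] by blast
  \<comment> \<open>Injectivity applies because \<open>x\<close> annihilates \<open>y'x - d\<close>:
    both \<open>xy'x\<close> and \<open>xd\<close> equal \<open>x\<close>.\<close>
  have "d \<otimes> (y' \<otimes> x \<ominus> d) = \<zero>"
    using y' x dD by (intro inj) (simp_all add: minus_eq r_distr r_minus m_assoc[symmetric] r_neg)
  then have "d \<otimes> y' \<otimes> x \<ominus> d = \<zero>"
    using y'(1) x(1) dD by (simp add: minus_eq r_distr r_minus m_assoc)
  then have dyx: "d \<otimes> y' \<otimes> x = d" using y'(1) x(1) dD(1) by simp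
  show ?thesis
  proof (rule that[of x "d \<otimes> y' \<otimes> b"])
    show "d \<otimes> y' \<otimes> b \<otimes> x = d" using dyx x y'(1) dD(1) bD(1) by (simp add: m_assoc)
  qed (use x y'(1) dD bD in \<open>simp_all add: m_assoc mult_absorb[OF dD(2)]\<close>)
qed

end

context irreducible_continuous_rank_ring
begin

text \<open>The upper bound given by upper continuity still meets both ideals trivially, as Zorn's
  lemma requires. The empty chain is covered as well: its upper bound meets every \<open>I\<close>
  trivially.\<close>

lemma exists_maximal_disjoint:
  assumes "d \<in> carrier R" "b \<in> carrier R"
  obtains g where "g \<in> carrier R" "rideal d \<inter> rideal g = {\<zero>}"
    "rideal b \<inter> rideal g = {\<zero>}"
    "\<And>k. k \<in> carrier R \<Longrightarrow> rideal d \<inter> rideal k = {\<zero>} \<Longrightarrow>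
      rideal b \<inter> rideal k = {\<zero>} \<Longrightarrow> g \<in> rideal k \<Longrightarrow> k \<in> rideal g"
proof -
  define A where "A = {J \<in> carrier L. rideal d \<inter> J = {\<zero>} \<and> rideal b \<inter> J = {\<zero>}}"
  have "\<exists>M\<in>A. \<forall>J\<in>A. M \<subseteq> J \<longrightarrow> J = M"
  proof (rule subset_Zorn)
    fix C assume "subset.chain A C"
    then have C: "C \<subseteq> carrier L" "\<forall>J\<in>C. \<forall>K\<in>C. J \<subseteq> K \<or> K \<subseteq> J"
      and dis: "\<And>J. J \<in> C \<Longrightarrow> rideal d \<inter> J = {\<zero>}" "\<And>J. J \<in> C \<Longrightarrow> rideal b \<inter> J = {\<zero>}"
      by (auto simp: subset_chain_def A_def)
    obtain K where K: "K \<in> carrier L" "\<And>J. J \<in> C \<Longrightarrow> J \<subseteq> K"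
      "\<And>I. I \<in> carrier L \<Longrightarrow> (\<And>J. J \<in> C \<Longrightarrow> I \<inter> J = {\<zero>}) \<Longrightarrow> I \<inter> K = {\<zero>}"
      using chain_upper_bound_disjoint[OF C] by metis
    have "K \<in> A" using K(1) K(3)[OF in_carrier_L] dis assms by (simp add: A_def)
    with K(2) show "\<exists>U\<in>A. \<forall>J\<in>C. J \<subseteq> U" by blast
  qed
  then obtain M where M: "M \<in> A" "\<And>J. J \<in> A \<Longrightarrow> M \<subseteq> J \<Longrightarrow> J = M" by blast
  obtain g where g: "g \<in> carrier R" "M = rideal g" using M(1) by (auto simp: A_def elim: carrier_LE)
  show ?thesis
  proof (rule that[OF g(1)])
    fix k assume k: "k \<in> carrier R" "rideal d \<inter> rideal k = {\<zero>}"
      "rideal b \<inter> rideal k = {\<zero>}" "g \<in> rideal k"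
    have "M \<subseteq> rideal k"
      unfolding g(2) by (rule rideal_subset_of_mem(2)[OF in_carrier_L[OF k(1)] k(4)])
    then have "rideal k = M" using M(2) k in_carrier_L by (simp add: A_def)
    then show "k \<in> rideal g" using mem_rideal_self[OF k(1)] g(2) by simp
  qed (use M(1) g(2) in \<open>auto simp: A_def\<close>)
qed

text \<open>If both inclusions failed, \<open>gR\<close> could be enlarged by the graph of a nonzero
  isomorphism between a piece of \<open>dR\<close> and a piece of \<open>bR\<close>. The conclusion
  is what \<open>embedding_of_graph\<close> requires, in one of the two directions.\<close>

lemma maximal_disjoint_sum:
  assumes d: "idem d" and b: "idem b" and g: "g \<in> carrier R"
    and gd: "rideal d \<inter> rideal g = {\<zero>}" and gb: "rideal b \<inter> rideal g = {\<zero>}"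
    and max: "\<And>k. k \<in> carrier R \<Longrightarrow> rideal d \<inter> rideal k = {\<zero>} \<Longrightarrow>
      rideal b \<inter> rideal k = {\<zero>} \<Longrightarrow> g \<in> rideal k \<Longrightarrow> k \<in> rideal g"
  shows "(\<exists>s\<in>carrier R. \<exists>t\<in>carrier R. d = b \<otimes> s \<oplus> g \<otimes> t) \<or>
    (\<exists>s\<in>carrier R. \<exists>t\<in>carrier R. b = d \<otimes> s \<oplus> g \<otimes> t)"
proof (rule ccontr)
  assume neg: "\<not> ?thesis"
  note dD = idemD[OF d] and bD = idemD[OF b]
  \<comment> \<open>The separating multiplier is \<open>1 - q\<close>, where \<open>q\<close>
    generates \<open>hR + gR\<close>: it annihilates this sum, and annihilates \<open>f\<close> only
    if \<open>f\<close> lies in it.\<close>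
  have outside: "\<exists>\<alpha>\<in>carrier R. \<alpha> \<otimes> f \<noteq> \<zero> \<and> \<alpha> \<otimes> h = \<zero> \<and> \<alpha> \<otimes> g = \<zero>"
    if f: "idem f" and h: "idem h"
      and no: "\<not> (\<exists>s\<in>carrier R. \<exists>t\<in>carrier R. f = h \<otimes> s \<oplus> g \<otimes> t)" for f h
  proof -
    note fD = idemD[OF f] and hD = idemD[OF h]
    obtain q s t where q: "idem q" "q \<otimes> h = h" "q \<otimes> g = g" "s \<in> carrier R" "t \<in> carrier R"
      "q = h \<otimes> s \<oplus> g \<otimes> t"
      using join_idem[OF h g] by metis
    note qD = idemD[OF q(1)]
    have "(\<one> \<ominus> q) \<otimes> f \<noteq> \<zero>"
    proof
      assume "(\<one> \<ominus> q) \<otimes> f = \<zero>"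
      moreover have "f = (\<one> \<ominus> q) \<otimes> f \<oplus> q \<otimes> f" using fD(1) qD(1) by algebra
      ultimately have "f = q \<otimes> f" using fD(1) qD(1) by simp
      also have "\<dots> = h \<otimes> (s \<otimes> f) \<oplus> g \<otimes> (t \<otimes> f)"
        using q hD g fD by (simp add: l_distr m_assoc)
      finally show False using no q fD by (meson m_closed)
    qed
    moreover have "(\<one> \<ominus> q) \<otimes> h = \<zero>" "(\<one> \<ominus> q) \<otimes> g = \<zero>"
      using q qD hD g by (simp_all add: minus_eq l_distr l_minus r_neg)
    ultimately show ?thesis using qD by (intro bexI[of _ "\<one> \<ominus> q"]) auto
  qed
  \<comment> \<open>Primeness yields a nonzero \<open>j\<close> linking the parts of \<open>dR\<close> and \<open>bR\<close> outside the two sums; adjoining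
    the graph element \<open>ds + bj\<close> then contradicts maximality.\<close>
  obtain \<alpha> where \<alpha>: "\<alpha> \<in> carrier R" "\<alpha> \<otimes> d \<noteq> \<zero>" "\<alpha> \<otimes> b = \<zero>" "\<alpha> \<otimes> g = \<zero>"
    using outside[OF d b] neg by blast
  obtain \<beta> where \<beta>: "\<beta> \<in> carrier R" "\<beta> \<otimes> b \<noteq> \<zero>" "\<beta> \<otimes> d = \<zero>" "\<beta> \<otimes> g = \<zero>"
    using outside[OF b d] neg by blast
  obtain \<alpha>' where \<alpha>': "\<alpha>' \<in> carrier R" "\<alpha> \<otimes> d \<otimes> \<alpha>' \<otimes> (\<alpha> \<otimes> d) = \<alpha> \<otimes> d" "idem (\<alpha>' \<otimes> (\<alpha> \<otimes> d))"
    using quasi_inverse[of "\<alpha> \<otimes> d"] \<alpha> dD by (metis m_closed)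
  obtain \<beta>' where \<beta>': "\<beta>' \<in> carrier R" "\<beta> \<otimes> b \<otimes> \<beta>' \<otimes> (\<beta> \<otimes> b) = \<beta> \<otimes> b" "idem (\<beta>' \<otimes> (\<beta> \<otimes> b))"
    using quasi_inverse[of "\<beta> \<otimes> b"] \<beta> bD by (metis m_closed)
  define e where "e = \<alpha>' \<otimes> (\<alpha> \<otimes> d)"
  define f where "f = \<beta>' \<otimes> (\<beta> \<otimes> b)"
  have ei: "idem e" and fi: "idem f" using \<alpha>' \<beta>' by (simp_all add: e_def f_def)
  note eD = idemD[OF ei] and fD = idemD[OF fi]
  have "e \<noteq> \<zero>" "f \<noteq> \<zero>"
    using \<alpha> \<alpha>' \<beta> \<beta>' dD bD by (auto simp: e_def f_def m_assoc)
  then obtain r0 where r0: "r0 \<in> carrier R" "f \<otimes> r0 \<otimes> e \<noteq> \<zero>"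
    using prime[OF fi eD(1)] by blast
  define j where "j = f \<otimes> r0 \<otimes> e"
  have j: "j \<in> carrier R" "j \<noteq> \<zero>" "f \<otimes> j = j" "j \<otimes> e = j"
    using r0 eD fD by (simp_all add: j_def m_assoc mult_absorb[OF fD(2)])
  obtain j' where j': "j' \<in> carrier R" "j \<otimes> j' \<otimes> j = j" using regular[OF j(1)] by blast
  \<comment> \<open>This choice gives \<open>s\<close> the same right annihilator as
    \<open>j\<close>. Moreover \<open>\<alpha>d\<close> is injective on \<open>sR\<close>, because
    \<open>es = s\<close>, and \<open>\<beta>b\<close> on \<open>jR\<close>, because
    \<open>fj = j\<close>. So \<open>dsr\<close> and \<open>bjr\<close> determine each other, and
    \<open>\<gamma>\<close> below generates the graph of this correspondence.\<close>
  define s where "s = e \<otimes> (j' \<otimes> j)"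
  have s: "s \<in> carrier R" "e \<otimes> s = s" "j \<otimes> s = j"
    using eD j j' by (simp_all add: s_def mult_absorb[OF eD(2)] mult_absorb[OF j(4)] m_assoc)
  have as: "s \<otimes> r = \<zero>" if "\<alpha> \<otimes> (d \<otimes> (s \<otimes> r)) = \<zero>" "r \<in> carrier R" for r
  proof -
    have "s \<otimes> r = e \<otimes> s \<otimes> r" using s by simp
    also have "\<dots> = \<alpha>' \<otimes> (\<alpha> \<otimes> (d \<otimes> (s \<otimes> r)))"
      using s(1) \<alpha> \<alpha>' dD that by (simp add: e_def m_assoc)
    finally show ?thesis using that \<alpha>' by simp
  qed
  have bj: "j \<otimes> r = \<zero>" if "\<beta> \<otimes> (b \<otimes> (j \<otimes> r)) = \<zero>" "r \<in> carrier R" for r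
  proof -
    have "j \<otimes> r = f \<otimes> j \<otimes> r" using j by simp
    also have "\<dots> = \<beta>' \<otimes> (\<beta> \<otimes> (b \<otimes> (j \<otimes> r)))"
      using j(1) \<beta> \<beta>' bD that by (simp add: f_def m_assoc)
    finally show ?thesis using that \<beta>' by simp
  qed
  have sj: "j \<otimes> r = \<zero>" if "s \<otimes> r = \<zero>" "r \<in> carrier R" for r
    using that s j by (metis m_assoc r_null)
  have js: "s \<otimes> r = \<zero>" if "j \<otimes> r = \<zero>" "r \<in> carrier R" for r
    using that eD(1) j j' by (simp add: s_def m_assoc)
  define \<gamma> where "\<gamma> = d \<otimes> s \<oplus> b \<otimes> j"
  have \<gamma>: "\<gamma> \<in> carrier R" using dD bD s j by (simp add: \<gamma>_def)
  have a\<gamma>: "\<alpha> \<otimes> (\<gamma> \<otimes> r) = \<alpha> \<otimes> (d \<otimes> (s \<otimes> r))" if "r \<in> carrier R" for r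
    using that \<alpha> dD(1) bD(1) s(1) j(1) by (simp add: \<gamma>_def r_distr l_distr m_assoc mult_absorb[OF \<alpha>(3)])
  have b\<gamma>: "\<beta> \<otimes> (\<gamma> \<otimes> r) = \<beta> \<otimes> (b \<otimes> (j \<otimes> r))" if "r \<in> carrier R" for r
    using that \<beta> dD(1) bD(1) s(1) j(1) by (simp add: \<gamma>_def r_distr l_distr m_assoc mult_absorb[OF \<beta>(3)])
  have \<gamma>0: "\<gamma> \<otimes> r = \<zero>" if "s \<otimes> r = \<zero>" "j \<otimes> r = \<zero>" "r \<in> carrier R" for r
    using that dD(1) bD(1) s(1) j(1) by (simp add: \<gamma>_def l_distr m_assoc)
  obtain g' where g': "g' \<in> carrier R" "idem (g \<otimes> g')" "g \<otimes> g' \<otimes> g = g"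
    using quasi_inverse[OF g] by metis
  obtain k u v where k: "idem k" "k \<otimes> (g \<otimes> g') = g \<otimes> g'" "k \<otimes> \<gamma> = \<gamma>" "u \<in> carrier R" "v \<in> carrier R"
    "k = g \<otimes> g' \<otimes> u \<oplus> \<gamma> \<otimes> v"
    using join_idem[OF g'(2) \<gamma>] by metis
  note kD = idemD[OF k(1)]
  \<comment> \<open>\<open>\<alpha>\<close> sees only the component \<open>dsr\<close> of
    \<open>gm + \<gamma>r\<close>, and \<open>\<beta>\<close> only \<open>bjr\<close>; if either is
    annihilated, both components of \<open>\<gamma>r\<close> vanish.\<close>
  have zero_split: "\<gamma> \<otimes> r = \<zero>"
    if r: "r \<in> carrier R" "m \<in> carrier R" and or: "\<alpha> \<otimes> (g \<otimes> m \<oplus> \<gamma> \<otimes> r) = \<zero> \<or> \<beta> \<otimes> (g \<otimes> m \<oplus> \<gamma> \<otimes> r) = \<zero>" for r m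
  proof -
    have "\<alpha> \<otimes> (d \<otimes> (s \<otimes> r)) = \<zero> \<or> \<beta> \<otimes> (b \<otimes> (j \<otimes> r)) = \<zero>"
      using or r \<alpha>(1) \<beta>(1) g \<gamma> a\<gamma>[OF r(1)] b\<gamma>[OF r(1)]
      using \<alpha>(1) \<beta>(1) dD(1) bD(1) s(1) j(1)
      by (simp add: r_distr mult_absorb[OF \<alpha>(4)] mult_absorb[OF \<beta>(4)])
    then show ?thesis using as bj sj js \<gamma>0 r by blast
  qed
  \<comment> \<open>A common element has the form \<open>gm + \<gamma>r\<close>. The multiplier that
    annihilates \<open>f0\<close> forces \<open>\<gamma>r = 0\<close>, which leaves an element of
    both \<open>f0R\<close> and \<open>gR\<close>.\<close>
  have disj: "rideal f0 \<inter> rideal k = {\<zero>}"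
    if f0: "f0 \<in> carrier R" "\<alpha> \<otimes> f0 = \<zero> \<or> \<beta> \<otimes> f0 = \<zero>" and gf: "rideal f0 \<inter> rideal g = {\<zero>}" for f0
  proof -
    have "z = \<zero>" if z: "z \<in> rideal f0" "z \<in> rideal k" for z
    proof -
      obtain w where w: "w \<in> carrier R" "z = f0 \<otimes> w" using z mem_rideal_iff by blast
      obtain w' where w': "w' \<in> carrier R" "z = k \<otimes> w'" using z mem_rideal_iff by blast
      define m where "m = g' \<otimes> (u \<otimes> w')"
      define r where "r = v \<otimes> w'"
      have mr: "m \<in> carrier R" "r \<in> carrier R" using g' k w' by (simp_all add: m_def r_def)
      have zz: "z = g \<otimes> m \<oplus> \<gamma> \<otimes> r"
        using w' k(4-6) g g'(1) \<gamma> by (simp add: m_def r_def l_distr m_assoc)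
      have "\<alpha> \<otimes> z = \<zero> \<or> \<beta> \<otimes> z = \<zero>"
        using f0 w \<alpha>(1) \<beta>(1) by (auto simp: m_assoc[symmetric])
      then have "\<gamma> \<otimes> r = \<zero>" using zero_split[OF mr(2,1)] zz by simp
      then have "z = g \<otimes> m" using zz g mr by simp
      then have "z \<in> rideal g" using mr mem_rideal_iff by blast
      then show ?thesis using gf z by blast
    qed
    moreover have "\<zero> \<in> rideal f0 \<inter> rideal k"
      using zero_mem[OF in_carrier_L] f0 kD by simp
    ultimately show ?thesis by blast
  qed
  have "k \<otimes> g = g" using k(2) g' g kD by (metis m_assoc m_closed)
  then have "g \<in> rideal k" using g mem_rideal_iff by metis
  then have "k \<in> rideal g"
    using max kD disj[OF dD(1) _ gd] disj[OF bD(1) _ gb] \<alpha>(3) \<beta>(3) by blast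
  then obtain w where w: "w \<in> carrier R" "k = g \<otimes> w" using mem_rideal_iff by blast
  \<comment> \<open>Maximality has put \<open>\<gamma>\<close> into \<open>gR\<close>, which
    \<open>\<alpha>\<close> annihilates; this forces \<open>j = 0\<close>.\<close>
  have "\<alpha> \<otimes> \<gamma> = \<alpha> \<otimes> (g \<otimes> w \<otimes> \<gamma>)" using k(3) w by simp
  also have "\<dots> = \<zero>" using w(1) \<gamma> g \<alpha>(1) by (simp add: m_assoc mult_absorb[OF \<alpha>(4)])
  finally have "\<alpha> \<otimes> (d \<otimes> (s \<otimes> \<one>)) = \<zero>" using a\<gamma>[OF one_closed] \<gamma> by simp
  then have "j \<otimes> \<one> = \<zero>" using as sj by blast
  then show False using j by simp
qed

text \<open>One of the two ideals embeds into the other. If \<open>bR\<close> embeds into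
  \<open>dR\<close>, the image idempotent \<open>y \<otimes> x\<close> lies below \<open>d\<close>
  and has rank at least \<open>rk b\<close>, hence at least \<open>rk d\<close>; faithfulness of the
  rank gives \<open>y \<otimes> x = d\<close>, so the same pair serves.\<close>

lemma comparability:
  assumes d: "idem d" and b: "idem b" and le: "rk d \<le> rk b"
  obtains x y where "x \<in> carrier R" "y \<in> carrier R" "b \<otimes> x = x" "x \<otimes> d = x"
    "d \<otimes> y = y" "y \<otimes> b = y" "y \<otimes> x = d"
proof -
  note dD = idemD[OF d] and bD = idemD[OF b]
  obtain g where g: "g \<in> carrier R" and gd: "rideal d \<inter> rideal g = {\<zero>}"
    and gb: "rideal b \<inter> rideal g = {\<zero>}"
    and max: "\<And>k. k \<in> carrier R \<Longrightarrow> rideal d \<inter> rideal k = {\<zero>} \<Longrightarrow>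
      rideal b \<inter> rideal k = {\<zero>} \<Longrightarrow> g \<in> rideal k \<Longrightarrow> k \<in> rideal g"
    using exists_maximal_disjoint[OF dD(1) bD(1)] by blast
  have "(\<exists>s\<in>carrier R. \<exists>t\<in>carrier R. d = b \<otimes> s \<oplus> g \<otimes> t) \<or>
    (\<exists>s\<in>carrier R. \<exists>t\<in>carrier R. b = d \<otimes> s \<oplus> g \<otimes> t)"
    by (rule maximal_disjoint_sum[OF d b g gd gb max])
  then show ?thesis
  proof (elim disjE bexE)
    fix s t assume "s \<in> carrier R" "t \<in> carrier R" "d = b \<otimes> s \<oplus> g \<otimes> t"
    from embedding_of_graph[OF d b g gd this] that show ?thesis by blast
  next
    fix s t assume "s \<in> carrier R" "t \<in> carrier R" "b = d \<otimes> s \<oplus> g \<otimes> t"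
    then obtain y x where yx: "y \<in> carrier R" "x \<in> carrier R" "d \<otimes> y = y" "y \<otimes> b = y"
      "b \<otimes> x = x" "x \<otimes> d = x" "x \<otimes> y = b"
      using embedding_of_graph[OF b d g gb] by metis
    have yxi: "idem (y \<otimes> x)"
      using yx by (simp add: idem_def m_assoc mult_absorb[OF yx(7)])
    have le': "d \<otimes> (y \<otimes> x) = y \<otimes> x" "y \<otimes> x \<otimes> d = y \<otimes> x"
      using yx dD(1) by (simp_all add: m_assoc mult_absorb[OF yx(3)])
    have "x \<otimes> (y \<otimes> x) \<otimes> y = b"
      using yx bD by (simp add: m_assoc mult_absorb[OF yx(7)])
    then have "rk b \<le> rk (y \<otimes> x)"
      using rk_mult_le[of "x \<otimes> (y \<otimes> x)" y] rk_mult_le[of x "y \<otimes> x"] yx by auto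
    then have "rk (d \<ominus> y \<otimes> x) = 0"
      using rk_diff_idem(2)[OF d yxi le'] rk_nonneg[of "d \<ominus> y \<otimes> x"] le dD(1) yx by simp
    then have "d \<ominus> y \<otimes> x = \<zero>" using rk_eq_0 dD(1) yx by simp
    then have "y \<otimes> x = d" using dD(1) yx by simp
    with that yx show ?thesis by blast
  qed
qed

end

section \<open>Involutions and unipotent units\<close>

context rank_ring
begin

lemma self_inverse_Units: "s \<in> carrier R \<Longrightarrow> s \<otimes> s = \<one> \<Longrightarrow> s \<in> Units R"
  by (auto simp: Units_def)

text \<open>The elements \<open>d\<close>, \<open>x \<otimes> y\<close>, \<open>x\<close>,
  \<open>y\<close> are 2 by 2 matrix units, and \<open>s\<close> is the permutation matrix
  exchanging \<open>d\<close> and \<open>x \<otimes> y\<close>, extended by the identity. The last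
  conclusion ensures that an idempotent already fixed by a unit stays fixed.\<close>

lemma swap_unit:
  assumes d: "idem d" and b: "b \<in> carrier R" and db: "d \<otimes> b = \<zero>" "b \<otimes> d = \<zero>"
    and x: "x \<in> carrier R" "b \<otimes> x = x" "x \<otimes> d = x"
    and y: "y \<in> carrier R" "d \<otimes> y = y" "y \<otimes> b = y" and yx: "y \<otimes> x = d"
  obtains s where "s \<in> Units R" "rk (\<one> \<ominus> s) \<le> rk d" "s \<otimes> d = x" "s \<otimes> x = d"
    "\<And>c. c \<in> carrier R \<Longrightarrow> c \<otimes> d = \<zero> \<Longrightarrow> d \<otimes> c = \<zero> \<Longrightarrow> c \<otimes> b = \<zero> \<Longrightarrow> b \<otimes> c = \<zero> \<Longrightarrow>
      s \<otimes> c = c \<and> c \<otimes> s = c"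
proof -
  note dD = idemD[OF d]
  have dx: "d \<otimes> x = \<zero>" using db x b dD by (metis m_assoc l_null)
  have yd: "y \<otimes> d = \<zero>" using db y b dD by (metis m_assoc r_null)
  \<comment> \<open>The unit is \<open>1 - d - xy + x + y\<close>; factoring its difference from \<open>1\<close> through \<open>d\<close> bounds the rank.\<close>
  define n where "n = (\<one> \<ominus> x) \<otimes> (d \<otimes> (\<one> \<ominus> y))"
  define s where "s = \<one> \<ominus> n"
  have n: "n \<in> carrier R" and s: "s \<in> carrier R" using x y dD by (simp_all add: n_def s_def)
  \<comment> \<open>The value \<open>2d\<close> yields \<open>n \<otimes> n = n \<oplus> n\<close>,
    so \<open>1 - n\<close> squares to \<open>1\<close> in every characteristic.\<close>
  have "d \<otimes> ((\<one> \<ominus> y) \<otimes> (\<one> \<ominus> x)) \<otimes> d = d \<oplus> d"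
    using x y dD dx yd yx
    by (simp add: minus_eq l_distr r_distr l_minus r_minus m_assoc mult_absorb[OF dx] minus_add)
  then have "(\<one> \<ominus> x) \<otimes> (d \<otimes> ((\<one> \<ominus> y) \<otimes> (\<one> \<ominus> x)) \<otimes> d) \<otimes> (\<one> \<ominus> y) = n \<oplus> n"
    using x y dD(1) by (simp add: n_def l_distr r_distr m_assoc)
  then have "n \<otimes> n = n \<oplus> n"
    using x y dD(1) by (simp add: n_def m_assoc)
  then have "s \<otimes> s = \<one>"
    unfolding s_def using n by (simp add: minus_eq l_distr r_distr l_minus r_minus) algebra
  then have su: "s \<in> Units R" using s by (rule self_inverse_Units[rotated])
  have "\<one> \<ominus> s = n" unfolding s_def using n by algebra
  then have rk: "rk (\<one> \<ominus> s) \<le> rk d"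
    using rk_mult_le(2)[of "\<one> \<ominus> x" "d \<otimes> (\<one> \<ominus> y)"] rk_mult_le(1)[of d "\<one> \<ominus> y"] x y dD
    by (simp add: n_def)
  have "n \<otimes> d = d \<ominus> x"
    using x y dD yd by (simp add: n_def minus_eq l_distr r_distr l_minus r_minus m_assoc)
  then have sd: "s \<otimes> d = x"
    unfolding s_def using n x dD by (simp add: minus_eq l_distr l_minus) algebra
  have "x \<otimes> x = \<zero>" using dx x dD by (metis m_assoc r_null)
  then have "n \<otimes> x = x \<ominus> d"
    using x y dD yx dx
    by (simp add: n_def minus_eq l_distr r_distr l_minus r_minus m_assoc minus_add a_comm)
  then have sx: "s \<otimes> x = d"
    unfolding s_def using n x dD by (simp add: minus_eq l_distr l_minus) algebra
  have "s \<otimes> c = c \<and> c \<otimes> s = c"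
    if c: "c \<in> carrier R" "c \<otimes> d = \<zero>" "d \<otimes> c = \<zero>" "c \<otimes> b = \<zero>" "b \<otimes> c = \<zero>" for c
  proof -
    have cx: "c \<otimes> x = \<zero>" using c x b by (metis m_assoc l_null)
    have yc: "y \<otimes> c = \<zero>" using c y b by (metis m_assoc r_null)
    have xc: "x \<otimes> c = \<zero>" using c x dD by (metis m_assoc r_null)
    have cy: "c \<otimes> y = \<zero>" using c y dD by (metis m_assoc l_null)
    have "n \<otimes> c = \<zero>" "c \<otimes> n = \<zero>"
      using c x y dD yc cx xc cy
      by (simp_all add: n_def minus_eq l_distr r_distr l_minus r_minus m_assoc
          mult_absorb[OF cx] mult_absorb[OF c(2)])
    then show ?thesis
      unfolding s_def using n c by (simp add: minus_eq l_distr r_distr l_minus r_minus)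
  qed
  with that su rk sd sx show ?thesis by blast
qed

lemma one_minus_nilpotent_Units:
  assumes "n \<in> carrier R" "n \<otimes> n = \<zero>"
  shows "\<one> \<ominus> n \<in> Units R"
proof -
  have "\<one> \<oplus> n \<oplus> \<ominus> n = \<one>" "\<one> \<oplus> \<ominus> n \<oplus> n = \<one>"
    using assms(1) by (simp_all add: a_assoc r_neg l_neg)
  then have "(\<one> \<ominus> n) \<otimes> (\<one> \<oplus> n) = \<one>" "(\<one> \<oplus> n) \<otimes> (\<one> \<ominus> n) = \<one>"
    using assms by (simp_all add: minus_eq l_distr r_distr l_minus r_minus)
  then show ?thesis using assms by (auto simp: Units_def)
qed

end

section \<open>Enlarging the idempotent fixed by a unit\<close>

context irreducible_continuous_rank_ring
begin

text \<open>Here \<open>g1 = s1 \<otimes> g\<close> takes \<open>e\<close> to \<open>x\<close>,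
  \<open>g2 = s2 \<otimes> g1\<close> takes it back to \<open>e\<close>, and \<open>h\<close> also
  fixes \<open>e\<close> from the other side. The factor 3 in \<open>room\<close> is needed because
  \<open>eR + geR\<close> may take up \<open>2 * rk e\<close> inside \<open>1 - c\<close>, while the
  copy of \<open>eR\<close> needs another \<open>rk e\<close>.\<close>

lemma enlarge_fixed_idem:
  assumes g: "g \<in> Units R" and c: "idem c" and gc: "g \<otimes> c = c" and cg: "c \<otimes> g = c"
    and e: "idem e" and ec: "e \<otimes> c = \<zero>" and ce: "c \<otimes> e = \<zero>"
    and room: "3 * rk e \<le> rk (\<one> \<ominus> c)"
  obtains g1 g2 h where "g1 \<in> Units R" "g2 \<in> Units R" "h \<in> Units R"
    "rk (g1 \<ominus> g) \<le> rk e" "rk (g2 \<ominus> g1) \<le> rk e" "rk (h \<ominus> g2) \<le> rk e"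
    "h \<otimes> (c \<oplus> e) = c \<oplus> e" "(c \<oplus> e) \<otimes> h = c \<oplus> e"
proof -
  note cD = idemD[OF c] and eD = idemD[OF e]
  define i where "i = inv g"
  have gC: "g \<in> carrier R" using g by (rule Units_closed)
  have i: "i \<in> carrier R" "i \<otimes> g = \<one>" "g \<otimes> i = \<one>"
    using g by (simp_all add: i_def)
  obtain q0 u v where q0: "idem q0" "q0 \<otimes> e = e" "e \<otimes> q0 = e" "q0 \<otimes> (g \<otimes> e) = g \<otimes> e"
    "rk q0 \<le> rk e + rk (g \<otimes> e)" "u \<in> carrier R" "v \<in> carrier R" "q0 = e \<otimes> u \<oplus> g \<otimes> e \<otimes> v"
    using join_idem[OF e m_closed[OF gC eD(1)]] by metis
  note q0D = idemD[OF q0(1)]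
  have cq0: "c \<otimes> q0 = \<zero>"
    unfolding q0(8) using cD(1) eD(1) gC q0(6,7)
    by (simp add: r_distr m_assoc mult_absorb[OF cg] mult_absorb[OF ce])
  \<comment> \<open>Only \<open>c \<otimes> q0 = \<zero>\<close> is known. The factor
    \<open>1 - c\<close> makes \<open>q\<close> orthogonal to \<open>c\<close> on both sides, keeps
    it idempotent and preserves its action on \<open>e\<close> and
    \<open>g \<otimes> e\<close>.\<close>
  define q where "q = q0 \<otimes> (\<one> \<ominus> c)"
  have q: "q \<in> carrier R" using q0D cD by (simp add: q_def)
  have qc: "q \<otimes> c = \<zero>" and cq: "c \<otimes> q = \<zero>"
    using q0D(1) cD idem_mult_compl(2)[OF c] cq0
    by (simp_all add: q_def m_assoc mult_absorb[OF cq0])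
  have q': "q = q0 \<ominus> q0 \<otimes> c"
    using q0D cD by (simp add: q_def minus_eq r_distr r_minus)
  have qq: "q \<otimes> q = q"
    unfolding q' using q0D(1) cD(1) cq0
    by (simp add: minus_eq l_distr r_distr l_minus r_minus m_assoc mult_absorb[OF cq0] mult_absorb[OF q0D(2)] q0D(2))
  have qi: "idem q" using q qq by (simp add: idem_def)
  have qe: "q \<otimes> e = e" and eq: "e \<otimes> q = e"
    unfolding q' using q0D(1) cD(1) eD(1) q0(2,3) ce ec
    by (simp_all add: minus_eq l_distr r_distr l_minus r_minus m_assoc mult_absorb[OF q0(3)])
  have qge: "q \<otimes> (g \<otimes> e) = g \<otimes> e"
    unfolding q' using q0D(1) cD(1) eD(1) gC q0(4) ce
    by (simp add: minus_eq l_distr l_minus m_assoc mult_absorb[OF cg])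
  have "rk q \<le> 2 * rk e"
    using rk_mult_le(1)[of q0 "\<one> \<ominus> c"] rk_unit_mult(1)[OF g eD(1)] q0(5) q0D(1) cD(1)
    by (simp add: q_def)
  define b where "b = \<one> \<ominus> c \<ominus> q"
  have "(\<one> \<ominus> c) \<otimes> q = q" "q \<otimes> (\<one> \<ominus> c) = q"
    using q cD(1) cq qc by (simp_all add: minus_eq l_distr r_distr l_minus r_minus)
  from rk_diff_idem[OF idem_compl[OF c] qi this]
  have bi: "idem b" and "rk b = rk (\<one> \<ominus> c) - rk q" by (simp_all add: b_def)
  with room \<open>rk q \<le> 2 * rk e\<close> have eb_le: "rk e \<le> rk b" by simp
  note bD = idemD[OF bi]
  have qb: "q \<otimes> b = \<zero>" and bq: "b \<otimes> q = \<zero>" and cb: "c \<otimes> b = \<zero>" and bc: "b \<otimes> c = \<zero>"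
    using q cD cq qc qq by (simp_all add: b_def minus_eq l_distr r_distr l_minus r_minus r_neg)
  have eb: "e \<otimes> b = \<zero>" using eq qb eD q bD by (metis m_assoc r_null)
  have be: "b \<otimes> e = \<zero>" using qe bq eD q bD by (metis m_assoc l_null)
  \<comment> \<open>\<open>D\<close> is the idempotent generating \<open>geR\<close> along a complement that contains \<open>bR\<close> and \<open>cR\<close>,
    so that it is orthogonal to both.\<close>
  define D where "D = g \<otimes> (e \<otimes> (i \<otimes> q))"
  have DC: "D \<in> carrier R" using gC eD i q by (simp add: D_def)
  have iz: "i \<otimes> (g \<otimes> z) = z" if "z \<in> carrier R" for z
    using mult_absorb[OF i(2) i(1) gC that] that by simp
  have Dge: "D \<otimes> (g \<otimes> e) = g \<otimes> e"
    using gC eD i q qge iz by (simp add: D_def m_assoc)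
  have "D \<otimes> D = D \<otimes> (g \<otimes> e) \<otimes> (i \<otimes> q)"
    using gC eD i q DC by (subst (2) D_def) (simp add: m_assoc)
  also have "\<dots> = D" using Dge gC eD i q by (simp add: D_def m_assoc)
  finally have Di: "idem D" using DC by (simp add: idem_def)
  have rkD: "rk D \<le> rk e"
    using rk_mult_le(2)[of g "e \<otimes> (i \<otimes> q)"] rk_mult_le(1)[of e "i \<otimes> q"] gC eD i q by (simp add: D_def)
  have Db: "D \<otimes> b = \<zero>" and Dc: "D \<otimes> c = \<zero>"
    using gC eD i q bD cD qb qc by (simp_all add: D_def m_assoc)
  have cge: "c \<otimes> (g \<otimes> e) = \<zero>" using mult_absorb[OF cg cD(1) gC eD(1)] ce by simp
  have bge: "b \<otimes> (g \<otimes> e) = \<zero>" using qge bq gC eD q bD by (metis m_assoc m_closed l_null)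
  have D': "D = g \<otimes> e \<otimes> (i \<otimes> q)" using gC eD i q by (simp add: D_def m_assoc)
  have bDz: "b \<otimes> D = \<zero>" and cDz: "c \<otimes> D = \<zero>"
    unfolding D' using mult_absorb[OF bge] mult_absorb[OF cge] bD(1) cD(1) gC eD(1) i(1) q by simp_all
  obtain x y where xy: "x \<in> carrier R" "y \<in> carrier R" "b \<otimes> x = x" "x \<otimes> e = x"
    "e \<otimes> y = y" "y \<otimes> b = y" "y \<otimes> x = e"
    using comparability[OF e bi eb_le] by metis
  obtain s2 where s2: "s2 \<in> Units R" "rk (\<one> \<ominus> s2) \<le> rk e" "s2 \<otimes> x = e" "s2 \<otimes> c = c" "c \<otimes> s2 = c"
    using swap_unit[OF e bD(1) eb be xy(1,3,4,2,5,6,7)] cD(1) ce ec cb bc by metis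
  \<comment> \<open>\<open>x1\<close> and \<open>y1\<close> transport \<open>x\<close> and
    \<open>y\<close> along \<open>g\<close> and match \<open>geR\<close> with the same copy
    \<open>xR\<close> of \<open>eR\<close>. Hence \<open>s1\<close> sends
    \<open>g \<otimes> e\<close> exactly to \<open>x\<close>, which \<open>s2\<close> sends to
    \<open>e\<close>.\<close>
  define x1 where "x1 = x \<otimes> (i \<otimes> D)"
  define y1 where "y1 = g \<otimes> y"
  have x1: "x1 \<in> carrier R" "b \<otimes> x1 = x1" "x1 \<otimes> D = x1"
    using xy i DC bD idemD(2)[OF Di] by (simp_all add: x1_def m_assoc mult_absorb[OF xy(3)])
  have "D \<otimes> y1 = D \<otimes> (g \<otimes> e) \<otimes> y"
    using xy(1,2,5) DC gC eD by (simp add: y1_def m_assoc)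
  then have y1: "y1 \<in> carrier R" "D \<otimes> y1 = y1" "y1 \<otimes> b = y1"
    using Dge xy gC eD bD by (simp_all add: y1_def m_assoc)
  have "y1 \<otimes> x1 = g \<otimes> (e \<otimes> (i \<otimes> D))"
    using xy(1,2) gC i DC eD(1) by (simp add: x1_def y1_def m_assoc mult_absorb[OF xy(7)])
  also have "\<dots> = D"
    unfolding D' using gC eD i q iz by (simp add: m_assoc mult_absorb[OF eD(2)])
  finally have yx1: "y1 \<otimes> x1 = D" .
  obtain s1 where s1: "s1 \<in> Units R" "rk (\<one> \<ominus> s1) \<le> rk D" "s1 \<otimes> D = x1" "s1 \<otimes> c = c" "c \<otimes> s1 = c"
    using swap_unit[OF Di bD(1) Db bDz x1 y1 yx1] cD(1) cDz Dc cb bc by metis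
  have sC: "s1 \<in> carrier R" "s2 \<in> carrier R" using s1 s2 by auto
  define g1 where "g1 = s1 \<otimes> g"
  define g2 where "g2 = s2 \<otimes> g1"
  have gU: "g1 \<in> Units R" "g2 \<in> Units R" using s1 s2 g by (simp_all add: g1_def g2_def)
  then have g12: "g1 \<in> carrier R" "g2 \<in> carrier R" by auto
  have "g1 \<otimes> e = s1 \<otimes> D \<otimes> (g \<otimes> e)"
    using Dge sC gC eD DC by (simp add: g1_def m_assoc)
  also have "\<dots> = x"
    using s1 Dge xy(1,4) i gC eD DC iz by (simp add: x1_def m_assoc)
  finally have g2e: "g2 \<otimes> e = e" using s2 sC g12 eD xy by (simp add: g2_def m_assoc)
  have g2c: "g2 \<otimes> c = c" using s1 s2 gc sC gC cD by (simp add: g2_def g1_def m_assoc)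
  have cg2: "c \<otimes> g2 = c" using s1 s2 cg sC gC cD
    by (simp add: g2_def g1_def mult_absorb[OF s2(5)] mult_absorb[OF s1(5)])
  have "g1 \<ominus> g = \<ominus> ((\<one> \<ominus> s1) \<otimes> g)" using sC gC unfolding g1_def by algebra
  then have r1: "rk (g1 \<ominus> g) \<le> rk e"
    using rk_uminus[of "(\<one> \<ominus> s1) \<otimes> g"] rk_mult_le(1)[of "\<one> \<ominus> s1" g] s1(2) rkD sC gC by simp
  have "g2 \<ominus> g1 = \<ominus> ((\<one> \<ominus> s2) \<otimes> g1)" using sC g12 unfolding g2_def by algebra
  then have r2: "rk (g2 \<ominus> g1) \<le> rk e"
    using rk_uminus[of "(\<one> \<ominus> s2) \<otimes> g1"] rk_mult_le(1)[of "\<one> \<ominus> s2" g1] s2(2) sC g12 by simp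
  \<comment> \<open>\<open>g2\<close> fixes \<open>e\<close> only from the right; \<open>1 - n\<close> repairs the left side.\<close>
  define n where "n = e \<otimes> (g2 \<otimes> (\<one> \<ominus> e))"
  have n: "n \<in> carrier R" using eD g12 by (simp add: n_def)
  have ne: "n \<otimes> e = \<zero>" using eD g12 idem_mult_compl(2)[OF e] by (simp add: n_def m_assoc)
  have en: "e \<otimes> n = n" using eD g12 by (simp add: n_def mult_absorb[OF eD(2)])
  have nn: "n \<otimes> n = \<zero>"
    using ne en n eD by (metis m_assoc l_null)
  have n': "n = e \<otimes> g2 \<ominus> e"
    using eD g12 g2e by (simp add: n_def minus_eq r_distr r_minus)
  have nc: "n \<otimes> c = \<zero>" and cn: "c \<otimes> n = \<zero>"
    unfolding n' using eD cD g12 g2c ec ce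
    by (simp_all add: minus_eq l_distr r_distr l_minus r_minus m_assoc mult_absorb[OF ce])
  have "e \<otimes> (g2 \<otimes> n) = e \<otimes> (g2 \<otimes> (e \<otimes> n))" using en by simp
  also have "\<dots> = e \<otimes> n" using eD g12 n by (simp add: mult_absorb[OF g2e] mult_absorb[OF eD(2)])
  also note en
  finally have egn: "e \<otimes> (g2 \<otimes> n) = n" .
  define h where "h = g2 \<otimes> (\<one> \<ominus> n)"
  have h: "h \<in> Units R" using one_minus_nilpotent_Units[OF n nn] gU by (simp add: h_def)
  have h': "h = g2 \<ominus> g2 \<otimes> n" using g12 n by (simp add: h_def minus_eq r_distr r_minus)
  have "h \<ominus> g2 = \<ominus> (g2 \<otimes> n)" using g12 n unfolding h' by algebra
  then have r3: "rk (h \<ominus> g2) \<le> rk e"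
    using rk_uminus[of "g2 \<otimes> n"] rk_mult_le(2)[of g2 n] rk_mult_le(1)[of e "g2 \<otimes> (\<one> \<ominus> e)"]
      g12 n eD by (simp add: n_def)
  have hx: "h \<otimes> c = c" "h \<otimes> e = e" "c \<otimes> h = c"
    unfolding h' using g12 n cD(1) eD(1) g2c g2e cg2 nc ne cn
    by (simp_all add: minus_eq l_distr r_distr l_minus r_minus m_assoc mult_absorb[OF cg2])
  have "e \<otimes> h = e \<otimes> g2 \<ominus> n"
    unfolding h' using g12 n eD(1) egn by (simp add: minus_eq r_distr r_minus)
  also have "\<dots> = e" unfolding n' using eD(1) g12 by algebra
  finally have "e \<otimes> h = e" .
  then have "h \<otimes> (c \<oplus> e) = c \<oplus> e" "(c \<oplus> e) \<otimes> h = c \<oplus> e"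
    using hx Units_closed[OF h] cD(1) eD(1) by (simp_all add: l_distr r_distr)
  with that gU h r1 r2 r3 show ?thesis by blast
qed

section \<open>Chains of small steps and Bourbaki boundedness\<close>

definition unit_step :: "real \<Rightarrow> ('a \<times> 'a) set" where
  "unit_step \<epsilon> = {(a, b). a \<in> Units R \<and> b \<in> Units R \<and> rk (a \<ominus> b) < \<epsilon>}"

text \<open>Each enlargement lowers the rank of \<open>1 - c\<close> by \<open>rk e0\<close> and
  costs three steps; once that rank is below \<open>3 * rk e0\<close>, one step suffices. The offset
  3 is this threshold, which is also the room that \<open>enlarge_fixed_idem\<close> requires. The
  length depends on \<open>k\<close> alone.\<close>

lemma unit_step_chain:
  assumes e0: "idem e0" and pos: "0 < rk e0" and eps: "3 * rk e0 \<le> \<epsilon>"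
  shows "\<lbrakk>g \<in> Units R; idem c; g \<otimes> c = c; c \<otimes> g = c; rk (\<one> \<ominus> c) < (real k + 3) * rk e0\<rbrakk> \<Longrightarrow>
    (\<one>, g) \<in> unit_step \<epsilon> ^^ (1 + 3 * k)"
proof (induction k arbitrary: g c)
  case 0
  note cD = idemD[OF \<open>idem c\<close>]
  have gC: "g \<in> carrier R" using 0 by auto
  have "(\<one> \<ominus> g) \<otimes> (\<one> \<ominus> c) = \<one> \<ominus> g"
    using gC cD(1) 0(3) by (simp add: minus_eq l_distr r_distr l_minus r_minus r_neg a_ac)
  then have "rk (\<one> \<ominus> g) \<le> rk (\<one> \<ominus> c)"
    using rk_mult_le(2)[of "\<one> \<ominus> g" "\<one> \<ominus> c"] gC cD by simp
  then show ?case using 0 eps by (simp add: unit_step_def)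
next
  case (Suc k)
  note gU = \<open>g \<in> Units R\<close> and c = \<open>idem c\<close>
  note cD = idemD[OF c] and e0D = idemD[OF e0]
  have comp: "(\<one>, g) \<in> unit_step \<epsilon> ^^ (1 + 3 * Suc k)"
    if "(\<one>, h0) \<in> unit_step \<epsilon> ^^ (1 + 3 * k)" "(h0, h1) \<in> unit_step \<epsilon>" "(h1, h2) \<in> unit_step \<epsilon>"
      "(h2, g) \<in> unit_step \<epsilon>" for h0 h1 h2
  proof -
    have "1 + 3 * Suc k = Suc (Suc (Suc (1 + 3 * k)))" by simp
    then show ?thesis using that by (simp only: relpow.simps) blast
  qed
  show ?case
  proof (cases "rk (\<one> \<ominus> c) < (real k + 3) * rk e0")
    case True
    \<comment> \<open>Boundedness asks for one length for all units, so three trivial steps are used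
      when the rank of \<open>1 - c\<close> already meets the bound for \<open>k\<close>.\<close>
    have "(g, g) \<in> unit_step \<epsilon>"
      using gU Units_closed[OF gU] pos eps by (simp add: unit_step_def minus_eq r_neg rk_zero)
    with comp Suc.IH[OF Suc.prems(1-4) True] show ?thesis by blast
  next
    case False
    have "3 * rk e0 \<le> (real k + 3) * rk e0" using pos by simp
    with False have room: "3 * rk e0 \<le> rk (\<one> \<ominus> c)" by linarith
    then have "rk e0 \<le> rk (\<one> \<ominus> c)" using pos by linarith
    then obtain x y where xy: "x \<in> carrier R" "y \<in> carrier R" "(\<one> \<ominus> c) \<otimes> x = x" "x \<otimes> e0 = x"
      "e0 \<otimes> y = y" "y \<otimes> (\<one> \<ominus> c) = y" "y \<otimes> x = e0"
      using comparability[OF e0 idem_compl[OF c]] by metis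
    \<comment> \<open>\<open>x \<otimes> y\<close> is the copy of \<open>e0\<close> below
      \<open>1 - c\<close>; it has the same rank, so the step size stays fixed throughout the
      induction.\<close>
    define e where "e = x \<otimes> y"
    have eC: "e \<in> carrier R" using xy by (simp add: e_def)
    have e: "idem e"
      using xy e0D(1) by (simp add: idem_def e_def m_assoc mult_absorb[OF xy(7)])
    have "c \<otimes> x = c \<otimes> (\<one> \<ominus> c) \<otimes> x" "y \<otimes> c = y \<otimes> ((\<one> \<ominus> c) \<otimes> c)"
      using xy cD(1) by (simp add: m_assoc, simp add: m_assoc[symmetric])
    then have cx: "c \<otimes> x = \<zero>" and yc: "y \<otimes> c = \<zero>"
      using idem_mult_compl[OF c] xy by simp_all
    have ec: "e \<otimes> c = \<zero>" "c \<otimes> e = \<zero>"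
      using yc cx xy(1,2) cD(1) by (simp_all add: e_def m_assoc mult_absorb[OF cx])
    have "y \<otimes> e \<otimes> x = e0"
      using xy(1,2,7) e0D by (simp add: e_def m_assoc mult_absorb[OF xy(7)])
    then have "rk e0 \<le> rk e"
      using rk_mult_le(1)[of "y \<otimes> e" x] rk_mult_le(2)[of y e] xy eC by simp
    moreover have "rk e \<le> rk e0"
      using rk_mult_le(2)[of x y] rk_mult_le(1)[of e0 y] xy e0D by (simp add: e_def)
    ultimately have rke: "rk e = rk e0" by simp
    obtain g1 g2 h where g12: "g1 \<in> Units R" "g2 \<in> Units R" "h \<in> Units R"
      "rk (g1 \<ominus> g) \<le> rk e" "rk (g2 \<ominus> g1) \<le> rk e" "rk (h \<ominus> g2) \<le> rk e"
      "h \<otimes> (c \<oplus> e) = c \<oplus> e" "(c \<oplus> e) \<otimes> h = c \<oplus> e"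
      using enlarge_fixed_idem[OF gU c Suc.prems(3,4) e ec] room rke by metis
    have ce: "idem (c \<oplus> e)" using idem_add[OF c e ec(2,1)] .
    have "rk (\<one> \<ominus> (c \<oplus> e)) < (real k + 3) * rk e0"
      using rk_compl[OF ce] rk_compl[OF c] rk_add_orth[OF c e ec(2,1)] rke Suc.prems(5)
      by (simp add: algebra_simps)
    from Suc.IH[OF g12(3) ce g12(7,8) this]
    have "(\<one>, h) \<in> unit_step \<epsilon> ^^ (1 + 3 * k)" .
    moreover have "(h, g2) \<in> unit_step \<epsilon>" "(g2, g1) \<in> unit_step \<epsilon>" "(g1, g) \<in> unit_step \<epsilon>"
      using g12 gU rke pos eps by (auto simp: unit_step_def)
    ultimately show ?thesis using comp by blast
  qed
qed

lemma bourbaki_bounded_Units: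
  assumes "rank_topology R rk \<noteq> discrete_topology (carrier R)"
  shows "bourbaki_bounded (Units R) (metric_uniformity (Units R) (rank_metric R rk))"
  unfolding bourbaki_bounded_def
proof (intro allI impI)
  fix E assume ev: "\<forall>\<^sub>F p in metric_uniformity (Units R) (rank_metric R rk). p \<in> E"
  let ?B = "\<lambda>\<epsilon>. {(x, y). x \<in> Units R \<and> y \<in> Units R \<and> rank_metric R rk x y < \<epsilon>}"
  \<comment> \<open>The sets \<open>?B\<close> are directed under \<open>min\<close>, so a property
    that holds eventually holds on one of them.\<close>
  have "\<exists>\<epsilon>\<in>{0<..}. \<forall>\<^sub>F p in principal (?B \<epsilon>). p \<in> E"
  proof (subst eventually_INF_base[symmetric])
    show "\<forall>\<^sub>F p in INF \<epsilon>\<in>{0<..}. principal (?B \<epsilon>). p \<in> E"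
      using ev by (simp add: metric_uniformity_def)
    show "\<exists>\<epsilon>\<in>{0<..}. principal (?B \<epsilon>) \<le> inf (principal (?B a)) (principal (?B b))"
      if "a \<in> {0<..}" "b \<in> {0<..}" for a b :: real
      using that by (intro bexI[of _ "min a b"]) auto
  qed auto
  then obtain \<epsilon> where \<epsilon>: "0 < \<epsilon>" "?B \<epsilon> \<subseteq> E" by (auto simp: eventually_principal)
  have step: "unit_step \<epsilon> \<subseteq> E"
    using \<epsilon>(2) by (force simp: unit_step_def rank_metric_def)
  obtain e where e: "idem e" "e \<noteq> \<zero>" "rk e < \<epsilon> / 3"
    using nondiscrete_small_rank[OF assms, of "\<epsilon> / 3"] \<epsilon>(1) by auto
  note eD = idemD[OF e(1)]
  have pos: "0 < rk e" using rk_nonneg[OF eD(1)] rk_eq_0[OF eD(1)] e(2) by fastforce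
  \<comment> \<open>The induction starts from \<open>c = 0\<close>, where \<open>1 - c\<close> has
    rank one; \<open>k\<close> makes the bound hold there, independently of the unit.\<close>
  obtain k where "1 / rk e < real k" using reals_Archimedean2 by blast
  then have "1 < (real k + 3) * rk e" using pos by (simp add: field_simps)
  then have k: "rk (\<one> \<ominus> \<zero>) < (real k + 3) * rk e" by (simp add: minus_eq rk_one)
  let ?n = "1 + 3 * k"
  have "\<exists>x. x 0 = \<one> \<and> x ?n = g \<and> (\<forall>i<?n. (x i, x (Suc i)) \<in> unit_step \<epsilon>)" if "g \<in> Units R" for g
    using unit_step_chain[OF e(1) pos _ that idem_zero _ _ k, of \<epsilon>] e(3) that
    by (simp only: relpow_fun_conv) auto
  \<comment> \<open>Every index is the source or the target of a step; index zero is the source of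
    the first step, which exists since \<open>?n\<close> is positive.\<close>
  moreover have "\<forall>i\<le>?n. x i \<in> Units R"
    if "\<forall>i<?n. (x i, x (Suc i)) \<in> unit_step \<epsilon>" for x
  proof (intro allI impI)
    fix i assume "i \<le> ?n"
    then show "x i \<in> Units R"
      using that[rule_format, of 0] that[rule_format, of "i - 1"] by (cases i) (auto simp: unit_step_def)
  qed
  ultimately show "\<exists>n F. finite F \<and> F \<subseteq> Units R \<and>
      (\<forall>y\<in>Units R. \<exists>x. x 0 \<in> F \<and> x n = y \<and> (\<forall>i\<le>n. x i \<in> Units R) \<and> (\<forall>i<n. (x i, x (Suc i)) \<in> E))"
    using step by (intro exI[of _ ?n] exI[of _ "{\<one>}"]) (simp, blast)
qed

end

theorem corollary6p13:
  fixes R :: "('a, 'm) ring_scheme" and rk :: "'a \<Rightarrow> real"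
  assumes "continuous_ring R"
    and "irreducible_ring R"
    and "rank_function R rk"
    and "rank_topology R rk \<noteq> discrete_topology (carrier R)"
  shows "bourbaki_bounded (Units R) (metric_uniformity (Units R) (rank_metric R rk))"
proof -
  have "regular_ring R" using assms(1) by (simp add: continuous_ring_def)
  then interpret ring R by (simp add: regular_ring_def)
  interpret irreducible_continuous_rank_ring R rk
    by unfold_locales (use assms \<open>regular_ring R\<close> in \<open>auto simp: regular_ring_def\<close>)
  show ?thesis using assms(4) by (rule bourbaki_bounded_Units)
qed

end
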